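(* Let $\mathbb{F}_q$ be a finite field with $q$ elements, fix an integer $r>0$ and a nonempty set $\mathcal{A}\subsetneq\mathbb{F}_q$. For integers $m,n\ge r$, let $\mathbf{M}$ be a random matrix chosen with uniform distribution from the set of $m\times n$ matrices over $\mathbb{F}_q$ of rank exactly $r$. Then, as $m,n\to+\infty$ (with $q$, $r$, $\mathcal{A}$ fixed), the random variable $$\frac{\operatorname{ct}_{\mathcal{A}}(\mathbf{M})-\mu_{\mathcal{A}}(q,m,n)}{\sqrt{\sigma^2_{\mathcal{A}}(q,m,n)}}$$ converges in distribution to a standard normal random variable.
   Context: For a matrix $\mathbf{N}$ over $\mathbb{F}_q$, $\operatorname{ct}_{\mathcal{A}}(\mathbf{N})$ denotes the number of entries of $\mathbf{N}$ that belong to $\mathcal{A}$. Put $\gamma_0(q):=q^{-1}-1$ and $\gamma_a(q):=q^{-1}$ for $a\in\mathbb{F}_q^*$, and $\gamma_{\mathcal{A}}(q):=\sum_{a\in\mathcal{A}}\gamma_a(q)$. Define $\mu_{\mathcal{A}}(q,m,n):=\big(|\mathcal{A}|q^{-1}-\gamma_{\mathcal{A}}(q)q^{-r}\big)mn$ and $\sigma^2_{\mathcal{A}}(q,m,n):=\gamma_{\mathcal{A}}(q)^2q^{-r}(1-q^{-r})(m+n)mn$. *)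

theory Defs
  imports "HOL-Probability.Probability" "Jordan_Normal_Form.DL_Rank"
begin

definition count_entries :: "'a set \<Rightarrow> 'a mat \<Rightarrow> nat" where
  "count_entries A N = card {(i, j). i < dim_row N \<and> j < dim_col N \<and> N $$ (i, j) \<in> A}"

text \<open>The field is the type \<open>'a\<close>, so \<open>q\<close> is \<open>CARD('a)\<close> throughout.\<close>

definition gamma_elem :: "'a::{field,finite} \<Rightarrow> real" where
  "gamma_elem a = (if a = 0 then 1 / real CARD('a) - 1 else 1 / real CARD('a))"

definition gamma_set :: "'a::{field,finite} set \<Rightarrow> real" where
  "gamma_set A = (\<Sum>a\<in>A. gamma_elem a)"

definition mu :: "'a::{field,finite} set \<Rightarrow> nat \<Rightarrow> nat \<Rightarrow> nat \<Rightarrow> real" where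
  "mu A r m n =
     (real (card A) / real CARD('a) - gamma_set A * (1 / real CARD('a)) ^ r) * real m * real n"

definition sigma2 :: "'a::{field,finite} set \<Rightarrow> nat \<Rightarrow> nat \<Rightarrow> nat \<Rightarrow> real" where
  "sigma2 A r m n =
     (gamma_set A)\<^sup>2 * (1 / real CARD('a)) ^ r * (1 - (1 / real CARD('a)) ^ r)
       * (real m + real n) * real m * real n"

text \<open>The first argument of \<^const>\<open>vec_space.rank\<close> is the number of rows, i.e. the dimension
  of the ambient space of the columns.\<close>

definition rank_mats :: "nat \<Rightarrow> nat \<Rightarrow> nat \<Rightarrow> 'a::{field,finite} mat set" where
  "rank_mats r m n = {N \<in> carrier_mat m n. vec_space.rank m N = r}"

text \<open>A \<^const>\<open>pmf_of_set\<close> is the uniform distribution only on a finite nonempty set; here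
  \<open>rank_mats r m n\<close> is finite, and it is nonempty exactly if \<open>r \<le> m\<close> and \<open>r \<le> n\<close>.\<close>

definition uniform_rank_mat :: "nat \<Rightarrow> nat \<Rightarrow> nat \<Rightarrow> 'a::{field,finite} mat pmf" where
  "uniform_rank_mat r m n = pmf_of_set (rank_mats r m n)"

text \<open>The library's \<^const>\<open>weak_conv_m\<close> only covers sequences of measures; this is its definition
  with an arbitrary index filter in place of \<^const>\<open>sequentially\<close>.\<close>

definition weak_conv_along :: "'i filter \<Rightarrow> ('i \<Rightarrow> real measure) \<Rightarrow> real measure \<Rightarrow> bool" where
  "weak_conv_along F Ms M \<longleftrightarrow>
     (\<forall>x. isCont (cdf M) x \<longrightarrow> ((\<lambda>i. cdf (Ms i) x) \<longlongrightarrow> cdf M x) F)"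

lemma weak_conv_along_sequentially: "weak_conv_along sequentially Ms M \<longleftrightarrow> weak_conv_m Ms M"
  by (simp add: weak_conv_along_def weak_conv_m_def weak_conv_def)

end

theory Submission
  imports Defs "HOL-Real_Asymp.Real_Asymp"
begin

unbundle no vec_syntax

text \<open>
  A uniform matrix of rank \<open>r\<close> is \<open>P Q\<^sup>T\<close> for uniform \<open>P\<close>, \<open>Q\<close> of full column rank \<open>r\<close>, since every
  matrix of rank \<open>r\<close> has as many such factorizations as \<open>GL\<^sub>r\<close> has elements; and uniform \<open>P\<close>, \<open>Q\<close>
  without any rank condition have full column rank with probability tending to 1, because all unit
  vectors then occur among their rows. With independent uniform rows \<open>u\<^sub>i\<close>, \<open>v\<^sub>j\<close>, the number of
  entries in \<open>A\<close> is the sum of the indicators of \<open>u\<^sub>i \<bullet> v\<^sub>j \<in> A\<close>. Its Hoeffding decomposition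
  consists of the mean, a linear part \<open>n \<Sum>\<^sub>i a(u\<^sub>i) + m \<Sum>\<^sub>j a(v\<^sub>j)\<close>, which accounts for the whole of the
  limiting variance because \<open>u \<bullet> v\<close> is uniformly distributed unless \<open>u\<close> or \<open>v\<close> vanishes, and a degenerate
  part whose variance is only of order \<open>m n\<close>. All errors are estimated on the level of characteristic
  functions, so that the double limit reduces to Levy's continuity theorem along sequences.
\<close>

section \<open>Full-rank factorizations\<close>

text \<open>Over a field this is full column rank \<open>r\<close>. The left inverse serves as a
  certificate with which \<open>P\<close> can be cancelled by plain matrix algebra.\<close>

definition left_invertible_mats :: "nat \<Rightarrow> nat \<Rightarrow> 'a::field mat set" where
  "left_invertible_mats m r = {P \<in> carrier_mat m r. \<exists>L\<in>carrier_mat r m. L * P = 1\<^sub>m r}"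

lemma left_invertible_matsE:
  assumes "P \<in> left_invertible_mats m r"
  obtains L where "P \<in> carrier_mat m r" "L \<in> carrier_mat r m" "L * P = 1\<^sub>m r"
  using assms by (auto simp: left_invertible_mats_def)

text \<open>Selecting rows is left multiplication by a matrix of unit vectors; the rows selected
  here are those of the identity.\<close>

lemma left_invertible_if_unit_rows:
  fixes P :: "'a::field mat"
  assumes P: "P \<in> carrier_mat m r" and rows: "\<And>j. j < r \<Longrightarrow> \<exists>i<m. row P i = unit_vec r j"
  shows "P \<in> left_invertible_mats m r"
proof -
  obtain i where i: "\<And>j. j < r \<Longrightarrow> i j < m" "\<And>j. j < r \<Longrightarrow> row P (i j) = unit_vec r j"
    using rows by metis
  define L :: "'a mat" where "L = mat_of_rows m (map (\<lambda>j. unit_vec m (i j)) [0..<r])"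
  have L: "L \<in> carrier_mat r m"
    unfolding L_def by (rule carrier_matI) simp_all
  have "L * P = 1\<^sub>m r"
  proof (rule eq_matI)
    fix j k assume jk: "j < dim_row (1\<^sub>m r :: 'a mat)" "k < dim_col (1\<^sub>m r :: 'a mat)"
    then have "(L * P) $$ (j, k) = unit_vec m (i j) \<bullet> col P k"
      using L P by (simp add: L_def)
    also have "\<dots> = row P (i j) $ k"
      using jk i(1) P by simp
    finally show "(L * P) $$ (j, k) = 1\<^sub>m r $$ (j, k)"
      using jk i(2) by (auto simp: unit_vec_def)
  qed (use L P in auto)
  with P L show ?thesis
    by (auto simp: left_invertible_mats_def)
qed

text \<open>The Gauss-Jordan form \<open>C = G * P\<close> has the same kernel as \<open>P\<close>.
  If the kernel is trivial, every column is a pivot column, so all unit vectors occur among the rows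
  of \<open>C\<close>; a left inverse of \<open>C\<close> composed with \<open>G\<close> is one of
  \<open>P\<close>.\<close>

lemma left_invertible_if_kernel_trivial:
  fixes P :: "'a::field mat"
  assumes P: "P \<in> carrier_mat m r"
    and ker: "\<And>x. x \<in> carrier_vec r \<Longrightarrow> P *\<^sub>v x = 0\<^sub>v m \<Longrightarrow> x = 0\<^sub>v r"
  shows "P \<in> left_invertible_mats m r"
proof -
  define C where "C = gauss_jordan_single P"
  note gj = gauss_jordan_single[OF P C_def[symmetric]]
  obtain G where G: "C = G * P" "G \<in> carrier_mat m m"
    using gj(4) by blast
  note C = gj(2)
  obtain f where piv: "pivot_fun C f r"
    using gj(3) C by (auto simp: row_echelon_form_def)
  \<comment> \<open>A column without a pivot would yield a nonzero kernel vector, by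
    \<open>find_base_vector\<close>.\<close>
  have "snd ` set (pivot_positions C) = {0..<r}"
  proof (rule ccontr)
    assume neq: "snd ` set (pivot_positions C) \<noteq> {0..<r}"
    note v = find_base_vector[OF gj(3) C neq]
    show False
      using ker[OF v(1)] gj(1)[OF v(1)] v(2,3) by simp
  qed
  then have "snd ` {(i, f i) |i. i < m \<and> f i \<noteq> r} = {0..<r}"
    unfolding pivot_positions(1)[OF C piv] .
  then have ex: "\<exists>i<m. f i = j" if "j < r" for j
  proof -
    have "j \<in> snd ` {(i, f i) |i. i < m \<and> f i \<noteq> r}"
      using that \<open>snd ` {(i, f i) |i. i < m \<and> f i \<noteq> r} = {0..<r}\<close> by simp
    then show ?thesis by auto
  qed
  have dim: "dim_row C = m"
    using C by simp
  \<comment> \<open>Column \<open>k\<close> is the pivot column of some row \<open>i'\<close>, so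
    its entry in any other row vanishes.\<close>
  have unit: "row C i = unit_vec r (f i)" if "i < m" "f i < r" for i
  proof (rule eq_vecI)
    fix k assume "k < dim_vec (unit_vec r (f i) :: 'a vec)"
    then have k: "k < r" by simp
    obtain i' where i': "i' < m" "f i' = k"
      using ex[OF k] by blast
    show "row C i $ k = unit_vec r (f i) $ k"
    proof (cases "i = i'")
      case True
      then show ?thesis using i' that k C pivot_funD(4)[OF dim piv that] by simp
    next
      case False
      have "C $$ (i, f i') = 0"
        using pivot_funD(5)[OF dim piv i'(1) _ that(1)] i' k False by simp
      moreover have "f i \<noteq> k"
        using pivot_funD(4)[OF dim piv that] \<open>C $$ (i, f i') = 0\<close> i'(2) by auto
      ultimately show ?thesis using i' that k C by simp
    qed
  qed (use C in simp)
  have "C \<in> left_invertible_mats m r"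
    by (rule left_invertible_if_unit_rows[OF C]) (use ex unit in blast)
  then obtain L where L: "L \<in> carrier_mat r m" "L * C = 1\<^sub>m r"
    by (rule left_invertible_matsE)
  have "(L * G) * P = 1\<^sub>m r"
    using L G P by (simp add: assoc_mult_mat[of _ _ m _ m])
  then show ?thesis
    using P L G by (auto simp: left_invertible_mats_def intro!: bexI[of _ "L * G"])
qed

section \<open>Counting vectors and matrices over a finite field\<close>

lemma bij_betw_rows:
  "bij_betw (\<lambda>P. \<lambda>i\<in>{..<m}. row P i) (carrier_mat m r) (PiE {..<m} (\<lambda>_. carrier_vec r))"
proof (rule bij_betwI[where g = "\<lambda>f. mat m r (\<lambda>(i, j). f i $ j)"])
  show "(\<lambda>i\<in>{..<m}. row (mat m r (\<lambda>(i, j). f i $ j)) i) = f"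
    if f: "f \<in> PiE {..<m} (\<lambda>_. carrier_vec r)" for f :: "nat \<Rightarrow> 'a vec"
  proof
    fix i
    show "(\<lambda>i\<in>{..<m}. row (mat m r (\<lambda>(i, j). f i $ j)) i) i = f i"
    proof (cases "i < m")
      case True
      then have "f i \<in> carrier_vec r" using f by auto
      then show ?thesis
        using True by (intro eq_vecI) (simp_all add: row_def)
    next
      case False
      then show ?thesis using PiE_arb[OF f, of i] by simp
    qed
  qed
next
  show "mat m r (\<lambda>(i, j). (\<lambda>i\<in>{..<m}. row P i) i $ j) = P" if "P \<in> carrier_mat m r" for P :: "'a mat"
    using that by (intro eq_matI) auto
  show "(\<lambda>P. \<lambda>i\<in>{..<m}. row P i) \<in> carrier_mat m r \<rightarrow> PiE {..<m} (\<lambda>_. carrier_vec r)"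
    by (intro Pi_I PiE_I) auto
  show "(\<lambda>f. mat m r (\<lambda>(i, j). f i $ j)) \<in> PiE {..<m} (\<lambda>_. carrier_vec r) \<rightarrow> carrier_mat m r"
    by (intro Pi_I) auto
qed

lemma finite_carrier_vec [simp]: "finite (carrier_vec r :: 'a::finite vec set)"
  and card_carrier_vec: "card (carrier_vec r :: 'a::finite vec set) = CARD('a) ^ r"
proof -
  have bij: "bij_betw (\<lambda>v. \<lambda>i\<in>{..<r}. v $ i) (carrier_vec r :: 'a vec set) (PiE {..<r} (\<lambda>_. UNIV))"
  proof (rule bij_betwI[where g = "\<lambda>f. vec r f"])
    show "(\<lambda>i\<in>{..<r}. vec r f $ i) = f" if f: "f \<in> PiE {..<r} (\<lambda>_. UNIV)" for f :: "nat \<Rightarrow> 'a"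
    proof
      fix i show "(\<lambda>i\<in>{..<r}. vec r f $ i) i = f i"
        using PiE_arb[OF f, of i] by (cases "i < r") auto
    qed
  qed auto
  have "finite (PiE {..<r} (\<lambda>_. UNIV :: 'a set))"
    by (simp add: finite_PiE)
  then show "finite (carrier_vec r :: 'a vec set)"
    using bij_betw_finite[OF bij] by simp
  show "card (carrier_vec r :: 'a vec set) = CARD('a) ^ r"
    using bij_betw_same_card[OF bij] by (simp add: card_PiE)
qed

lemma finite_carrier_mat [simp]: "finite (carrier_mat m r :: 'a::finite mat set)"
proof -
  have "finite (PiE {..<m} (\<lambda>_. carrier_vec r :: 'a vec set))"
    by (simp add: finite_PiE)
  then show ?thesis
    using bij_betw_finite[OF bij_betw_rows] by blast
qed

text \<open>Since \<open>X\<close> undoes \<open>Y\<close>, multiplication by \<open>Y\<close>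
  injects \<open>q^r\<close> vectors into \<open>q^s\<close> vectors, where
  \<open>q = CARD('a)\<close> is at least 2.\<close>

lemma mult_eq_one_mat_dim_le:
  fixes X Y :: "'a::{field,finite} mat"
  assumes X: "X \<in> carrier_mat r s" and Y: "Y \<in> carrier_mat s r" and XY: "X * Y = 1\<^sub>m r"
  shows "r \<le> s"
proof -
  have inv: "X *\<^sub>v (Y *\<^sub>v x) = x" if "x \<in> carrier_vec r" for x
    using that X Y XY by (simp flip: assoc_mult_mat_vec)
  have "inj_on (\<lambda>x. Y *\<^sub>v x) (carrier_vec r)"
    by (rule inj_onI) (metis inv)
  then have "CARD('a) ^ r \<le> CARD('a) ^ s"
    using card_inj_on_le[of "\<lambda>x. Y *\<^sub>v x" "carrier_vec r" "carrier_vec s"] Y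
    by (simp add: card_carrier_vec image_subset_iff)
  moreover have "card {0, 1 :: 'a} \<le> CARD('a)"
    by (rule card_mono) auto
  ultimately show ?thesis
    by simp
qed

section \<open>Rank factorizations and their number\<close>

text \<open>The columns of \<open>P\<close> are a maximal independent set of columns of
  \<open>N\<close>, and the rows of \<open>Q\<close> are the coordinates of the columns of
  \<open>N\<close> in this basis. \<open>Q\<close> has full rank because the basis vectors are
  themselves columns of \<open>N\<close>, with unit vectors as coordinates.\<close>

lemma rank_factorization:
  fixes N :: "'a::field mat"
  assumes N: "N \<in> carrier_mat m n"
  obtains P Q where "P \<in> left_invertible_mats m (vec_space.rank m N)"
    "Q \<in> left_invertible_mats n (vec_space.rank m N)" "N = P * Q\<^sup>T"
proof -
  interpret vec_space "TYPE('a)" m .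
  let ?indpt = "\<lambda>T. T \<subseteq> set (cols N) \<and> lin_indpt T"
  obtain S where S: "finite S" "maximal S ?indpt"
    using maximal_exists_superset[of "set (cols N)" ?indpt "{}"]
    by (auto simp: finite_lin_indpt2)
  define r where "r = vec_space.rank m N"
  have r: "card S = r"
    using rank_card_indpt[OF N S(2)] by (simp add: r_def)
  have Ssub: "S \<subseteq> set (cols N)" and Sli: "lin_indpt S"
    using S(2) by (auto simp: maximal_def)
  have cN: "set (cols N) \<subseteq> carrier_vec m"
    using N cols_dim by blast
  obtain vs where vs: "set vs = S" "distinct vs"
    using finite_distinct_list[OF S(1)] by blast
  have lvs: "length vs = r"
    using vs r distinct_card by fastforce
  define P where "P = mat_of_cols m vs"
  have P: "P \<in> carrier_mat m r" and cP: "cols P = vs"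
    using lvs vs Ssub cN by (auto simp: P_def cols_mat_of_cols)
  have Pfull: "P \<in> left_invertible_mats m r"
  proof (rule left_invertible_if_kernel_trivial[OF P])
    fix x assume "x \<in> carrier_vec r" "P *\<^sub>v x = 0\<^sub>v m"
    then show "x = 0\<^sub>v r"
      using lin_depI[OF P] vs cP Sli by auto
  qed
  have Scarr: "S \<subseteq> carrier_vec m"
    using Ssub cN by auto
  \<comment> \<open>A column outside the span could be added to \<open>S\<close>, contradicting
    maximality.\<close>
  have span: "v \<in> span S" if "v \<in> set (cols N)" for v
  proof (rule ccontr)
    assume nin: "v \<notin> span S"
    have vc: "v \<in> carrier_vec m" using that cN by auto
    have "v \<notin> S" using nin span_mem[OF Scarr, of v] by metis
    moreover have "lin_indpt (S \<union> {v})"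
      using lin_dep_iff_in_span[OF _ Sli _ \<open>v \<notin> S\<close>] nin Scarr vc by simp
    ultimately show False
      using S(2) that Ssub by (auto simp: maximal_def)
  qed
  have "\<exists>y\<in>carrier_vec r. P *\<^sub>v y = col N j" if "j < n" for j
  proof -
    have "col N j \<in> col_space P"
      using span[of "col N j"] that N vs cP by (auto simp: col_space_def cols_def)
    then show ?thesis
      using P by (auto simp: col_space_eq[OF P])
  qed
  then obtain y where y: "\<And>j. j < n \<Longrightarrow> y j \<in> carrier_vec r" "\<And>j. j < n \<Longrightarrow> P *\<^sub>v y j = col N j"
    by metis
  define Q where "Q = mat n r (\<lambda>(j, i). y j $ i)"
  have Q: "Q \<in> carrier_mat n r"
    by (simp add: Q_def)
  have rowQ: "row Q j = y j" if "j < n" for j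
    using that y(1)[OF that] by (auto simp: Q_def intro!: eq_vecI)
  have NPQ: "N = P * Q\<^sup>T"
  proof (rule eq_matI)
    fix i j assume "i < dim_row (P * Q\<^sup>T)" "j < dim_col (P * Q\<^sup>T)"
    then have ij: "i < m" "j < n" using P Q by auto
    have "(P * Q\<^sup>T) $$ (i, j) = (P *\<^sub>v y j) $ i"
      using ij P Q rowQ by simp
    also have "\<dots> = N $$ (i, j)"
      using y(2) ij N by simp
    finally show "N $$ (i, j) = (P * Q\<^sup>T) $$ (i, j)" by simp
  qed (use N P Q in auto)
  obtain L where L: "L \<in> carrier_mat r m" "L * P = 1\<^sub>m r"
    using Pfull by (rule left_invertible_matsE)
  have "Q \<in> left_invertible_mats n r"
  proof (rule left_invertible_if_unit_rows[OF Q])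
    fix k assume k: "k < r"
    then have "vs ! k \<in> set (cols N)"
      using lvs vs Ssub by auto
    then obtain j where j: "j < n" "vs ! k = col N j"
      using N by (auto simp: cols_def)
    \<comment> \<open>Both \<open>y j\<close> and \<open>unit_vec r k\<close> are coordinates of the
      basis column \<open>vs ! k\<close>; cancelling \<open>P\<close> with \<open>L\<close>
      identifies them.\<close>
    have "P *\<^sub>v unit_vec r k = col P k"
      using P k by (intro eq_vecI) auto
    then have "P *\<^sub>v y j = P *\<^sub>v unit_vec r k"
      using y(2)[OF j(1)] j(2) k P cP by (metis carrier_matD(2) cols_nth)
    then have "L *\<^sub>v (P *\<^sub>v y j) = L *\<^sub>v (P *\<^sub>v unit_vec r k)"
      by simp
    then have "y j = unit_vec r k"
      using L P y(1)[OF j(1)] by (simp flip: assoc_mult_mat_vec)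
    with rowQ j(1) show "\<exists>i<n. row Q i = unit_vec r k" by auto
  qed
  with Pfull NPQ that show thesis
    by (simp add: r_def)
qed

lemma assoc_mult_mat4:
  assumes "A \<in> carrier_mat a b" "B \<in> carrier_mat b c" "C \<in> carrier_mat c d" "D \<in> carrier_mat d e"
  shows "(A * B) * (C * D) = A * (B * C) * (D :: 'a::semiring_1 mat)"
  using assms assoc_mult_mat[OF assms(1,2) mult_carrier_mat[OF assms(3,4)]]
    assoc_mult_mat[OF assms(1) mult_carrier_mat[OF assms(2,3)] assms(4)]
    assoc_mult_mat[OF assms(2,3,4)] by simp

text \<open>The inner dimension of a full-rank factorization is determined by the product. Comparing
  a given one with that of \<open>rank_factorization\<close>, in both directions, shows that it
  equals the rank.\<close>

lemma rank_mats_factorization: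
  fixes N :: "'a::{field,finite} mat"
  shows "N \<in> rank_mats r m n \<longleftrightarrow>
    (\<exists>P\<in>left_invertible_mats m r. \<exists>Q\<in>left_invertible_mats n r. N = P * Q\<^sup>T)"
proof
  assume "N \<in> rank_mats r m n"
  then have "N \<in> carrier_mat m n" "vec_space.rank m N = r"
    by (auto simp: rank_mats_def)
  then show "\<exists>P\<in>left_invertible_mats m r. \<exists>Q\<in>left_invertible_mats n r. N = P * Q\<^sup>T"
    by (metis rank_factorization)
next
  \<comment> \<open>Multiplying the common product by \<open>L\<close> on the left and
    \<open>R\<^sup>T\<close> on the right gives the identity of size \<open>s\<close>, written as a
    product through dimension \<open>t\<close>.\<close>
  have le: "s \<le> t"
    if PQ: "P \<in> left_invertible_mats m s" "Q \<in> left_invertible_mats n s"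
      and PQ': "P' \<in> carrier_mat m t" "Q' \<in> carrier_mat n t" and eq: "P * Q\<^sup>T = P' * Q'\<^sup>T"
    for s t and P Q P' Q' :: "'a mat"
  proof -
    obtain L where L: "P \<in> carrier_mat m s" "L \<in> carrier_mat s m" "L * P = 1\<^sub>m s"
      using PQ(1) by (rule left_invertible_matsE)
    obtain R where R: "Q \<in> carrier_mat n s" "R \<in> carrier_mat s n" "R * Q = 1\<^sub>m s"
      using PQ(2) by (rule left_invertible_matsE)
    have QR: "Q\<^sup>T * R\<^sup>T = 1\<^sub>m s"
      using R by (metis transpose_mult transpose_one)
    have "(L * P') * (Q'\<^sup>T * R\<^sup>T) = L * (P' * Q'\<^sup>T) * R\<^sup>T"
      by (rule assoc_mult_mat4) (use L R PQ' in auto)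
    also have "\<dots> = (L * P) * (Q\<^sup>T * R\<^sup>T)"
      unfolding eq[symmetric] by (rule assoc_mult_mat4[symmetric]) (use L R in auto)
    also have "\<dots> = 1\<^sub>m s"
      using L QR by simp
    finally show ?thesis
      by (rule mult_eq_one_mat_dim_le[rotated -1]) (use L R PQ' in auto)
  qed
  assume "\<exists>P\<in>left_invertible_mats m r. \<exists>Q\<in>left_invertible_mats n r. N = P * Q\<^sup>T"
  then obtain P Q where PQ: "P \<in> left_invertible_mats m r" "Q \<in> left_invertible_mats n r"
    and N: "N = P * Q\<^sup>T" by blast
  have Nc: "N \<in> carrier_mat m n"
    using PQ N by (auto simp: left_invertible_mats_def)
  obtain P' Q' where PQ': "P' \<in> left_invertible_mats m (vec_space.rank m N)"
    "Q' \<in> left_invertible_mats n (vec_space.rank m N)" "N = P' * Q'\<^sup>T"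
    by (rule rank_factorization[OF Nc])
  have "r \<le> vec_space.rank m N"
    by (rule le[OF PQ, of P' _ Q']) (use PQ' N in \<open>auto simp: left_invertible_mats_def\<close>)
  moreover have "vec_space.rank m N \<le> r"
    by (rule le[OF PQ'(1,2), of P _ Q]) (use PQ' N PQ in \<open>auto simp: left_invertible_mats_def\<close>)
  ultimately show "N \<in> rank_mats r m n"
    using Nc by (simp add: rank_mats_def)
qed

text \<open>The group \<open>GL_r\<close>, each element listed together with its inverse.\<close>

definition inverse_pairs :: "nat \<Rightarrow> ('a::semiring_1 mat \<times> 'a mat) set" where
  "inverse_pairs r = {(G, H). G \<in> carrier_mat r r \<and> H \<in> carrier_mat r r \<and> G * H = 1\<^sub>m r \<and> H * G = 1\<^sub>m r}"

text \<open>The general linear group acts simply transitively on the factorizations of a fixed matrix.\<close>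

lemma card_rank_factorizations:
  fixes N :: "'a::{field,finite} mat"
  assumes N: "N \<in> rank_mats r m n"
  shows "card {(P, Q) \<in> left_invertible_mats m r \<times> left_invertible_mats n r. P * Q\<^sup>T = N}
    = card (inverse_pairs r :: ('a mat \<times> 'a mat) set)"
proof -
  obtain P Q where PQ: "P \<in> left_invertible_mats m r" "Q \<in> left_invertible_mats n r"
    and NPQ: "N = P * Q\<^sup>T"
    using N rank_mats_factorization by blast
  obtain L where L: "P \<in> carrier_mat m r" "L \<in> carrier_mat r m" "L * P = 1\<^sub>m r"
    using PQ(1) by (rule left_invertible_matsE)
  obtain R where R: "Q \<in> carrier_mat n r" "R \<in> carrier_mat r n" "R * Q = 1\<^sub>m r"
    using PQ(2) by (rule left_invertible_matsE)
  have RT: "R\<^sup>T \<in> carrier_mat n r" "Q\<^sup>T \<in> carrier_mat r n" and QR: "Q\<^sup>T * R\<^sup>T = 1\<^sub>m r"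
    using R by (auto simp: transpose_mult[OF R(2,1), symmetric])
  let ?F = "{(P, Q) \<in> left_invertible_mats m r \<times> left_invertible_mats n r. P * Q\<^sup>T = N}"
  have LPX: "L * (P * X) = X" if "X \<in> carrier_mat r t" for X t
    using that L by (simp add: assoc_mult_mat[of L r m P r X t, symmetric])
  have XQR: "X * Q\<^sup>T * R\<^sup>T = X" if "X \<in> carrier_mat t r" for X t
    using that RT QR by (simp add: assoc_mult_mat[of X t r "Q\<^sup>T" n "R\<^sup>T" r])
  \<comment> \<open>The change of basis between two factorizations is invertible: multiply
    \<open>P' * Q'\<^sup>T = P * Q\<^sup>T\<close> by \<open>L\<close> on the left and by
    \<open>R\<^sup>T\<close> on the right.\<close>
  have inv: "(L * P') * (Q'\<^sup>T * R\<^sup>T) = 1\<^sub>m r" "(Q'\<^sup>T * R\<^sup>T) * (L * P') = 1\<^sub>m r"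
    if "P' \<in> carrier_mat m r" "Q' \<in> carrier_mat n r" "P' * Q'\<^sup>T = N" for P' Q'
  proof -
    have "(L * P') * (Q'\<^sup>T * R\<^sup>T) = L * (P' * Q'\<^sup>T) * R\<^sup>T"
      by (rule assoc_mult_mat4) (use L RT that in auto)
    also have "\<dots> = (L * P) * (Q\<^sup>T * R\<^sup>T)"
      unfolding that(3) NPQ by (rule assoc_mult_mat4[symmetric]) (use L RT in auto)
    also have "\<dots> = 1\<^sub>m r"
      using L QR by simp
    finally show "(L * P') * (Q'\<^sup>T * R\<^sup>T) = 1\<^sub>m r" .
    then show "(Q'\<^sup>T * R\<^sup>T) * (L * P') = 1\<^sub>m r"
      by (rule mat_mult_left_right_inverse[rotated 2]) (use L RT that in auto)
  qed
  \<comment> \<open>\<open>G\<close> acts on the first factor and its inverse \<open>H\<close> on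
    the second, so the product stays \<open>N\<close>. The fixed one-sided inverses \<open>L\<close>
    and \<open>R\<^sup>T\<close> read \<open>G\<close> and \<open>H\<close> off a
    factorization.\<close>
  have "bij_betw (\<lambda>(G, H). (P * G, (H * Q\<^sup>T)\<^sup>T)) (inverse_pairs r) ?F"
  proof (rule bij_betwI[where g = "\<lambda>(P', Q'). (L * P', Q'\<^sup>T * R\<^sup>T)"])
    show "(\<lambda>(G, H). (P * G, (H * Q\<^sup>T)\<^sup>T)) \<in> inverse_pairs r \<rightarrow> ?F"
    proof (intro Pi_I, clarsimp simp: inverse_pairs_def, intro conjI)
      fix G H :: "'a mat"
      assume G: "G \<in> carrier_mat r r" and H: "H \<in> carrier_mat r r"
        and GH: "G * H = 1\<^sub>m r" and HG: "H * G = 1\<^sub>m r"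
      have "(H * L) * (P * G) = H * (L * (P * G))"
        by (rule assoc_mult_mat) (use L G H in auto)
      also have "\<dots> = 1\<^sub>m r"
        using HG G by (simp add: LPX)
      finally show "P * G \<in> left_invertible_mats m r"
        using L G H by (auto simp: left_invertible_mats_def intro!: bexI[of _ "H * L"])
      have "(H * Q\<^sup>T) * (R\<^sup>T * G) = (H * Q\<^sup>T * R\<^sup>T) * G"
        by (rule assoc_mult_mat[symmetric]) (use RT G H in auto)
      also have "\<dots> = 1\<^sub>m r"
        using HG H by (simp add: XQR)
      finally have "(R\<^sup>T * G)\<^sup>T * (H * Q\<^sup>T)\<^sup>T = 1\<^sub>m r"
        using transpose_mult[of "H * Q\<^sup>T" r n "R\<^sup>T * G" r] RT G H by simp
      then show "(H * Q\<^sup>T)\<^sup>T \<in> left_invertible_mats n r"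
        using RT G H by (auto simp: left_invertible_mats_def intro!: bexI[of _ "(R\<^sup>T * G)\<^sup>T"])
      have "P * G * (H * Q\<^sup>T) = P * (G * (H * Q\<^sup>T))"
        by (rule assoc_mult_mat) (use L RT G H in auto)
      also have "G * (H * Q\<^sup>T) = G * H * Q\<^sup>T"
        by (rule assoc_mult_mat[symmetric]) (use RT G H in auto)
      finally show "P * G * (H * Q\<^sup>T) = N"
        using GH RT NPQ by simp
    qed
    show "(\<lambda>(P', Q'). (L * P', Q'\<^sup>T * R\<^sup>T)) \<in> ?F \<rightarrow> inverse_pairs r"
    proof (intro Pi_I, clarify, goal_cases)
      case (1 P' Q')
      then show ?case
        using inv[of P' Q'] mult_carrier_mat[OF L(2), of P'] R(2)
        by (auto simp: inverse_pairs_def left_invertible_mats_def)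
    qed
    show "(case (case x of (G, H) \<Rightarrow> (P * G, (H * Q\<^sup>T)\<^sup>T)) of (P', Q') \<Rightarrow> (L * P', Q'\<^sup>T * R\<^sup>T)) = x"
      if "x \<in> inverse_pairs r" for x
      using that L R by (auto simp: inverse_pairs_def LPX XQR)
    show "(case (case y of (P', Q') \<Rightarrow> (L * P', Q'\<^sup>T * R\<^sup>T)) of (G, H) \<Rightarrow> (P * G, (H * Q\<^sup>T)\<^sup>T)) = y"
      if "y \<in> ?F" for y
    proof -
      obtain P' Q' where y: "y = (P', Q')" "P' \<in> carrier_mat m r" "Q' \<in> carrier_mat n r" "P' * Q'\<^sup>T = N"
        using \<open>y \<in> ?F\<close> by (auto simp: left_invertible_mats_def)
      note GH = inv[OF y(2-4)]
      let ?G = "L * P'" and ?H = "Q'\<^sup>T * R\<^sup>T"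
      have carr: "?G \<in> carrier_mat r r" "?H \<in> carrier_mat r r" "Q'\<^sup>T \<in> carrier_mat r n"
        using L RT y(2,3) by auto
      have "P = P * Q\<^sup>T * R\<^sup>T"
        using XQR L by simp
      also have "\<dots> = P' * ?H"
        unfolding NPQ[symmetric] y(4)[symmetric] by (rule assoc_mult_mat) (use y RT in auto)
      finally have "P * ?G = P' * (?H * ?G)"
        using assoc_mult_mat[OF y(2) carr(2,1)] by simp
      then have 1: "P * ?G = P'"
        using GH y by simp
      have "Q\<^sup>T = L * (P * Q\<^sup>T)"
        using LPX RT by simp
      also have "\<dots> = ?G * Q'\<^sup>T"
        unfolding NPQ[symmetric] y(4)[symmetric] by (rule assoc_mult_mat[symmetric]) (use y L in auto)
      finally have "?H * Q\<^sup>T = ?H * ?G * Q'\<^sup>T"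
        using assoc_mult_mat[OF carr(2,1,3)] by simp
      then have 2: "?H * Q\<^sup>T = Q'\<^sup>T"
        using GH carr by simp
      show ?thesis
        using 1 2 y(1) by simp
    qed
  qed
  then show ?thesis
    by (simp add: bij_betw_same_card)
qed

section \<open>Averages over matrices with independent rows\<close>

text \<open>Expanding the product of sums chooses one vector for each row, hence one matrix. This is
  independence of the rows in counting form.\<close>

lemma sum_rows_prod:
  fixes h :: "nat \<Rightarrow> 'a::finite vec \<Rightarrow> 'c::comm_semiring_1"
  shows "(\<Sum>P\<in>carrier_mat m r. \<Prod>i<m. h i (row P i)) = (\<Prod>i<m. \<Sum>v\<in>carrier_vec r. h i v)"
proof -
  have "(\<Prod>i<m. \<Sum>v\<in>carrier_vec r. h i v) = (\<Sum>g\<in>PiE {..<m} (\<lambda>_. carrier_vec r). \<Prod>i<m. h i (g i))"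
    by (rule prod_sum_PiE) auto
  also have "\<dots> = (\<Sum>P\<in>carrier_mat m r. \<Prod>i<m. h i ((\<lambda>i\<in>{..<m}. row P i) i))"
    by (rule sum.reindex_bij_betw[OF bij_betw_rows, symmetric])
  finally show ?thesis
    by simp
qed

lemma card_carrier_mat: "card (carrier_mat m r :: 'a::finite mat set) = card (carrier_vec r :: 'a vec set) ^ m"
  using sum_rows_prod[of "\<lambda>_ (_ :: 'a vec). 1 :: nat" m r] by simp

lemma carrier_vec_nonempty [simp]: "(carrier_vec r :: 'a vec set) \<noteq> {}"
proof -
  have "vec r (\<lambda>_. undefined :: 'a) \<in> carrier_vec r"
    by (rule vec_carrier)
  then show ?thesis by (metis empty_iff)
qed

lemma card_carrier_vec_pos [simp]: "0 < card (carrier_vec r :: 'a::finite vec set)"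
  by (simp add: card_carrier_vec)

lemma card_carrier_mat_pos [simp]: "0 < card (carrier_mat m r :: 'a::finite mat set)"
  by (simp add: card_carrier_mat)

lemma carrier_mat_nonempty [simp]: "(carrier_mat m r :: 'a::finite mat set) \<noteq> {}"
  using card_carrier_mat_pos[of m r, where 'a = 'a] by (metis card.empty less_irrefl)

text \<open>The expectation under the uniform distribution, with real scaling so that it serves real
  and complex values alike. On empty and infinite sets it is 0.\<close>

definition average :: "'b set \<Rightarrow> ('b \<Rightarrow> 'c::real_vector) \<Rightarrow> 'c" where
  "average S f = sum f S /\<^sub>R real (card S)"

lemma average_cong: "(\<And>x. x \<in> S \<Longrightarrow> f x = g x) \<Longrightarrow> average S f = average S g"
  by (simp add: average_def)

lemma average_add: "average S (\<lambda>x. f x + g x) = average S f + average S g"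
  by (simp add: average_def sum.distrib scaleR_add_right)

lemma average_diff: "average S (\<lambda>x. f x - g x) = average S f - average S g"
  by (simp add: average_def sum_subtractf scaleR_diff_right)

lemma average_mult_left: "average S (\<lambda>x. c * f x) = c * (average S f :: 'c::real_algebra)"
  by (simp add: average_def sum_distrib_left)

lemma average_mult_right: "average S (\<lambda>x. f x * c) = (average S f :: 'c::real_algebra) * c"
  by (simp add: average_def sum_distrib_right)

lemma average_const: "finite S \<Longrightarrow> S \<noteq> {} \<Longrightarrow> average S (\<lambda>_. c) = c"
  by (simp add: average_def sum_constant_scaleR)

lemma average_sum: "average S (\<lambda>x. \<Sum>i\<in>I. f i x) = (\<Sum>i\<in>I. average S (f i))"
  unfolding average_def by (subst sum.swap) (simp add: scaleR_right.sum)

lemma average_swap: "average S (\<lambda>x. average T (f x)) = average T (\<lambda>y. average S (\<lambda>x. f x y))"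
  unfolding average_def scaleR_right.sum[symmetric]
  by (subst sum.swap) (simp add: mult.commute)

lemma average_Times: "average (S \<times> T) f = average S (\<lambda>x. average T (\<lambda>y. f (x, y)))"
  by (simp add: average_def sum.cartesian_product scaleR_right.sum[symmetric] card_cartesian_product)

lemma average_mult_Times:
  fixes f :: "'b \<Rightarrow> 'd::real_algebra"
  shows "average (S \<times> T) (\<lambda>(x, y). f x * g y) = average S f * average T g"
  by (simp add: average_Times average_mult_left average_mult_right)

lemma average_mono:
  fixes f g :: "'b \<Rightarrow> real"
  assumes "\<And>x. x \<in> S \<Longrightarrow> f x \<le> g x"
  shows "average S f \<le> average S g"
  unfolding average_def by (intro scaleR_left_mono sum_mono assms) auto

lemma average_nonneg:
  fixes f :: "'b \<Rightarrow> real"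
  assumes "\<And>x. x \<in> S \<Longrightarrow> 0 \<le> f x"
  shows "0 \<le> average S f"
  unfolding average_def by (simp add: sum_nonneg assms)

lemma norm_average_le: "norm (average S f) \<le> average S (\<lambda>x. norm (f x))"
  by (simp add: average_def norm_sum mult_left_mono)

lemma norm_average_le_1:
  assumes "\<And>x. x \<in> S \<Longrightarrow> norm (f x) \<le> 1"
  shows "norm (average S f) \<le> 1"
proof (cases "finite S \<and> S \<noteq> {}")
  case True
  have "average S (\<lambda>x. norm (f x)) \<le> average S (\<lambda>_. 1)"
    by (rule average_mono) (use assms in auto)
  with True show ?thesis
    using norm_average_le[of S f] by (simp add: average_const)
qed (auto simp: average_def)

text \<open>The variance is nonnegative.\<close>

lemma average_square_le: "(average S f)\<^sup>2 \<le> average S (\<lambda>x. (f x :: real)\<^sup>2)"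
proof (cases "finite S \<and> S \<noteq> {}")
  case True
  have "0 \<le> average S (\<lambda>x. (f x - average S f)\<^sup>2)"
    by (rule average_nonneg) simp
  also have "\<dots> = average S (\<lambda>x. (f x)\<^sup>2 - (2 * average S f) * f x + (average S f)\<^sup>2)"
    by (simp add: power2_eq_square algebra_simps)
  also have "\<dots> = average S (\<lambda>x. (f x)\<^sup>2) - (average S f)\<^sup>2"
    using True unfolding average_add average_diff average_mult_left
    by (simp add: average_const power2_eq_square)
  finally show ?thesis by simp
qed (auto simp: average_def)

text \<open>Conditioning on \<open>S\<close> changes the mean in two ways, by the normalization and
  by the omitted terms. Each contributes at most the proportion of \<open>T - S\<close>, whence the
  factor 2.\<close>

lemma norm_average_subset_diff_le:
  fixes f :: "'b \<Rightarrow> 'c::real_normed_vector"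
  assumes T: "finite T" and S: "S \<subseteq> T" "S \<noteq> {}" and f: "\<And>x. x \<in> T \<Longrightarrow> norm (f x) \<le> 1"
  shows "norm (average S f - average T f) \<le> 2 * (real (card (T - S)) / real (card T))"
proof -
  define s t where "s = real (card S)" and "t = real (card T)"
  have fin: "finite S" using S T finite_subset by blast
  have pos: "0 < s" using S fin by (auto simp: s_def card_gt_0_iff)
  have le: "s \<le> t" using card_mono[OF T S(1)] by (simp add: s_def t_def)
  have d: "real (card (T - S)) = t - s"
    using card_Diff_subset[OF fin S(1)] card_mono[OF T S(1)] by (simp add: s_def t_def)
  have "sum f T = sum f S + sum f (T - S)"
    using sum.subset_diff[OF S(1) T, of f] by (simp add: add.commute)
  then have "average S f - average T f = (1 / s - 1 / t) *\<^sub>R sum f S - (1 / t) *\<^sub>R sum f (T - S)"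
    by (simp add: average_def s_def t_def scaleR_diff_left scaleR_add_right divide_inverse)
  also have "norm \<dots> \<le> (1 / s - 1 / t) * norm (sum f S) + (1 / t) * norm (sum f (T - S))"
    using pos le by (intro order.trans[OF norm_triangle_ineq4]) (auto simp: frac_le)
  also have "\<dots> \<le> (1 / s - 1 / t) * s + (1 / t) * (t - s)"
  proof (intro add_mono mult_left_mono)
    show "norm (sum f S) \<le> s"
      using sum_norm_le[of S f "\<lambda>_. 1"] f S by (auto simp: s_def)
    show "norm (sum f (T - S)) \<le> t - s"
      using sum_norm_le[of "T - S" f "\<lambda>_. 1"] f d by auto
  qed (use pos le in \<open>auto simp: frac_le\<close>)
  also have "\<dots> = 2 * ((t - s) / t)"
    using pos le by (simp add: field_simps)
  finally show ?thesis
    by (simp add: d t_def)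
qed

lemma average_rows_prod:
  fixes g :: "'a::finite vec \<Rightarrow> complex"
  shows "average (carrier_mat m r) (\<lambda>P. \<Prod>i<m. g (row P i)) = average (carrier_vec r) g ^ m"
  using sum_rows_prod[of "\<lambda>_. g" m r]
  by (simp add: average_def card_carrier_mat scaleR_conv_of_real power_mult_distrib power_inverse)

text \<open>The variance of a sum of independent centred terms: the mixed terms vanish.\<close>

lemma average_rows_sum_square:
  fixes g :: "'a::finite vec \<Rightarrow> real"
  assumes g: "average (carrier_vec r) g = 0"
  shows "average (carrier_mat m r) (\<lambda>P. (\<Sum>i<m. g (row P i))\<^sup>2)
    = real m * average (carrier_vec r) (\<lambda>v. (g v)\<^sup>2)"
proof -
  let ?V = "carrier_vec r :: 'a vec set" and ?M = "carrier_mat m r :: 'a mat set"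
  have sum0: "sum g ?V = 0"
    using g by (simp add: average_def)
  have cross: "(\<Sum>P\<in>?M. g (row P i) * g (row P k))
      = (if i = k then (\<Sum>v\<in>?V. (g v)\<^sup>2) * real (card ?V) ^ (m - 1) else 0)"
    if ik: "i < m" "k < m" for i k
  proof -
    \<comment> \<open>Padding with ones turns \<open>g (row P i) * g (row P k)\<close> into a
      product over all rows, so that \<open>sum_rows_prod\<close> applies.\<close>
    define h where "h l v = (if l = i then g v else 1) * (if l = k then g v else 1)" for l v
    have "(\<Sum>P\<in>?M. g (row P i) * g (row P k)) = (\<Sum>P\<in>?M. \<Prod>l<m. h l (row P l))"
      using ik by (simp add: h_def prod.distrib)
    also have "\<dots> = (\<Prod>l<m. \<Sum>v\<in>?V. h l v)"
      by (rule sum_rows_prod)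
    also have "\<dots> = (if i = k then (\<Sum>v\<in>?V. (g v)\<^sup>2) * real (card ?V) ^ (m - 1) else 0)"
    proof (cases "i = k")
      case True
      have "(\<Prod>l<m. \<Sum>v\<in>?V. h l v) = (\<Sum>v\<in>?V. h i v) * (\<Prod>l\<in>{..<m} - {i}. \<Sum>v\<in>?V. h l v)"
        using ik by (intro prod.remove) auto
      also have "(\<Prod>l\<in>{..<m} - {i}. \<Sum>v\<in>?V. h l v) = (\<Prod>l\<in>{..<m} - {i}. real (card ?V))"
        using True by (intro prod.cong) (auto simp: h_def)
      finally show ?thesis
        using True ik by (simp add: h_def power2_eq_square)
    next
      case False
      then have "(\<Sum>v\<in>?V. h i v) = 0"
        using sum0 by (simp add: h_def)
      with False ik show ?thesis
        by auto
    qed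
    finally show ?thesis .
  qed
  have "(\<Sum>P\<in>?M. (\<Sum>i<m. g (row P i))\<^sup>2) = (\<Sum>P\<in>?M. \<Sum>i<m. \<Sum>k<m. g (row P i) * g (row P k))"
    by (simp add: power2_eq_square sum_product)
  also have "\<dots> = (\<Sum>i<m. \<Sum>k<m. \<Sum>P\<in>?M. g (row P i) * g (row P k))"
    by (subst sum.swap, intro sum.cong refl sum.swap)
  also have "\<dots> = (\<Sum>i<m. \<Sum>k<m. if i = k then (\<Sum>v\<in>?V. (g v)\<^sup>2) * real (card ?V) ^ (m - 1) else 0)"
    by (intro sum.cong refl cross) auto
  also have "\<dots> = real m * ((\<Sum>v\<in>?V. (g v)\<^sup>2) * real (card ?V) ^ (m - 1))"
    by simp
  finally have S: "(\<Sum>P\<in>?M. (\<Sum>i<m. g (row P i))\<^sup>2)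
      = real m * ((\<Sum>v\<in>?V. (g v)\<^sup>2) * real (card ?V) ^ (m - 1))" .
  \<comment> \<open>The exponent \<open>m - 1\<close> is truncated at \<open>m = 0\<close>, where
    both sides are 0; otherwise one factor \<open>card ?V\<close> remains after cancelling.\<close>
  show ?thesis
  proof (cases m)
    case 0
    then show ?thesis by (simp add: average_def)
  next
    case (Suc k)
    define c x where "c = real (card ?V)" and "x = (\<Sum>v\<in>?V. (g v)\<^sup>2)"
    have "c \<noteq> 0" by (simp add: c_def)
    then have "inverse (c ^ m) * (real m * (x * c ^ (m - 1))) = real m * (inverse c * x)"
      by (simp add: Suc field_simps)
    then show ?thesis
      unfolding average_def S card_carrier_mat of_nat_power real_scaleR_def c_def x_def .
  qed
qed

text \<open>\<open>average_rows_sum_square\<close> is used twice: over \<open>P\<close> with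
  \<open>Q\<close> fixed, then over \<open>Q\<close> with a single vector \<open>u\<close> in place
  of the rows of \<open>P\<close>. Degeneracy in both arguments keeps the variance at order
  \<open>m n\<close>.\<close>

lemma average_bilinear_square:
  fixes h :: "'a::finite vec \<Rightarrow> 'a vec \<Rightarrow> real"
  assumes h1: "\<And>v. v \<in> carrier_vec r \<Longrightarrow> average (carrier_vec r) (\<lambda>u. h u v) = 0"
    and h2: "\<And>u. u \<in> carrier_vec r \<Longrightarrow> average (carrier_vec r) (h u) = 0"
  shows "average (carrier_mat m r \<times> carrier_mat n r) (\<lambda>(P, Q). (\<Sum>i<m. \<Sum>j<n. h (row P i) (row Q j))\<^sup>2)
    = real m * real n * average (carrier_vec r) (\<lambda>u. average (carrier_vec r) (\<lambda>v. (h u v)\<^sup>2))"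
proof -
  let ?V = "carrier_vec r :: 'a vec set"
  have inner: "average (carrier_mat m r) (\<lambda>P. (\<Sum>i<m. \<Sum>j<n. h (row P i) (row Q j))\<^sup>2)
      = real m * average ?V (\<lambda>u. (\<Sum>j<n. h u (row Q j))\<^sup>2)"
    if "Q \<in> carrier_mat n r" for Q
  proof (rule average_rows_sum_square[of r "\<lambda>u. \<Sum>j<n. h u (row Q j)"])
    show "average ?V (\<lambda>u. \<Sum>j<n. h u (row Q j)) = 0"
      unfolding average_sum using that by (intro sum.neutral ballI h1) auto
  qed
  have "average (carrier_mat m r \<times> carrier_mat n r) (\<lambda>(P, Q). (\<Sum>i<m. \<Sum>j<n. h (row P i) (row Q j))\<^sup>2)
      = average (carrier_mat m r) (\<lambda>P. average (carrier_mat n r) (\<lambda>Q. (\<Sum>i<m. \<Sum>j<n. h (row P i) (row Q j))\<^sup>2))"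
    by (simp only: average_Times prod.case)
  also have "\<dots> = average (carrier_mat n r) (\<lambda>Q. average (carrier_mat m r) (\<lambda>P. (\<Sum>i<m. \<Sum>j<n. h (row P i) (row Q j))\<^sup>2))"
    by (rule average_swap)
  also have "\<dots> = average (carrier_mat n r) (\<lambda>Q. real m * average ?V (\<lambda>u. (\<Sum>j<n. h u (row Q j))\<^sup>2))"
    by (rule average_cong) (rule inner)
  also have "\<dots> = real m * average (carrier_mat n r) (\<lambda>Q. average ?V (\<lambda>u. (\<Sum>j<n. h u (row Q j))\<^sup>2))"
    by (rule average_mult_left)
  also have "average (carrier_mat n r) (\<lambda>Q. average ?V (\<lambda>u. (\<Sum>j<n. h u (row Q j))\<^sup>2))
      = average ?V (\<lambda>u. average (carrier_mat n r) (\<lambda>Q. (\<Sum>j<n. h u (row Q j))\<^sup>2))"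
    by (rule average_swap)
  also have "\<dots> = average ?V (\<lambda>u. real n * average ?V (\<lambda>v. (h u v)\<^sup>2))"
    by (rule average_cong) (rule average_rows_sum_square, rule h2)
  also have "\<dots> = real n * average ?V (\<lambda>u. average ?V (\<lambda>v. (h u v)\<^sup>2))"
    by (rule average_mult_left)
  finally show ?thesis
    by simp
qed

section \<open>Taylor estimates for characteristic functions\<close>

text \<open>The upper bound on \<open>exp (- y)\<close> comes from
  \<open>exp y \<ge> 1 + y + y^2/2\<close> and the identity
  \<open>(1 - y + y^2/2) (1 + y + y^2/2) = 1 + y^4/4\<close>.\<close>

lemma abs_one_minus_exp_le:
  fixes y :: real
  assumes "0 \<le> y"
  shows "\<bar>(1 - y) - exp (- y)\<bar> \<le> y\<^sup>2 / 2"
proof -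
  have "(1 - y + z) * (1 + y + z) = 1 + z * z" if "2 * z = y * y" for z
  proof -
    have "(1 - y + z) * (1 + y + z) = 1 + 2 * z + z * z - y * y"
      by (simp add: algebra_simps)
    with that show ?thesis by simp
  qed
  from this[of "y\<^sup>2 / 2"] have "1 \<le> (1 - y + y\<^sup>2 / 2) * (1 + y + y\<^sup>2 / 2)"
    by (simp add: power2_eq_square)
  also have "\<dots> \<le> (1 - y + y\<^sup>2 / 2) * exp y"
  proof (rule mult_left_mono)
    have "0 \<le> (1 - y)\<^sup>2" by simp
    then show "0 \<le> 1 - y + y\<^sup>2 / 2"
      by (simp add: power2_diff)
  qed (use exp_lower_Taylor_quadratic[OF assms] in simp)
  finally have "exp (- y) \<le> 1 - y + y\<^sup>2 / 2"
    by (simp add: exp_minus field_simps)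
  moreover have "1 - y \<le> exp (- y)"
    using exp_ge_add_one_self[of "- y"] by simp
  ultimately show ?thesis by simp
qed

text \<open>The quadratic Taylor polynomial of \<open>iexp\<close> averages to
  \<open>1 - w x^2/2\<close>, because the mean is 0. The cubic remainder gives the first error term,
  and replacing \<open>1 - y\<close> by \<open>exp (- y)\<close> the second.\<close>

lemma average_iexp_approx:
  fixes a :: "'b \<Rightarrow> real"
  assumes V: "finite V" "V \<noteq> {}" and mean: "average V a = 0"
  shows "cmod (average V (\<lambda>v. iexp (x * a v)) - exp (- (average V (\<lambda>v. (a v)\<^sup>2) * x\<^sup>2 / 2)))
    \<le> average V (\<lambda>v. \<bar>a v\<bar> ^ 3) * \<bar>x\<bar> ^ 3 / 6 + (average V (\<lambda>v. (a v)\<^sup>2) * x\<^sup>2)\<^sup>2 / 8"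
proof -
  define w where "w = average V (\<lambda>v. (a v)\<^sup>2)"
  have "0 \<le> w"
    unfolding w_def by (rule average_nonneg) simp
  define T where "T y = (\<Sum>k\<le>2. (\<i> * complex_of_real y) ^ k / fact k)" for y
  have T: "T y = 1 + \<i> * y - complex_of_real (y\<^sup>2 / 2)" for y
  proof -
    have "{..2 :: nat} = {0, 1, 2}" by (auto simp: numeral_2_eq_2)
    then show ?thesis
      by (simp add: T_def power_mult_distrib)
  qed
  have "average V (\<lambda>v. T (x * a v)) = 1 + (\<i> * x) * complex_of_real (average V a) - complex_of_real (x\<^sup>2 / 2 * w)"
  proof -
    have of_real: "complex_of_real (average V f) = average V (\<lambda>v. complex_of_real (f v))" for f
      by (simp add: average_def scaleR_conv_of_real)
    have "average V (\<lambda>v. T (x * a v)) = average V (\<lambda>v. 1 + (\<i> * x) * complex_of_real (a v)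
        - complex_of_real (x\<^sup>2 / 2) * complex_of_real ((a v)\<^sup>2))"
      by (simp add: T power_mult_distrib mult.assoc)
    then show ?thesis
      using V unfolding average_add average_diff average_mult_left w_def of_real
      by (simp add: average_const of_real)
  qed
  then have avT: "average V (\<lambda>v. T (x * a v)) = complex_of_real (1 - w * x\<^sup>2 / 2)"
    using mean by (simp add: mult.commute)
  have "cmod (average V (\<lambda>v. iexp (x * a v)) - average V (\<lambda>v. T (x * a v)))
      \<le> average V (\<lambda>v. cmod (iexp (x * a v) - T (x * a v)))"
    unfolding average_diff[symmetric] by (rule norm_average_le)
  also have "\<dots> \<le> average V (\<lambda>v. (\<bar>x\<bar> ^ 3 / 6) * \<bar>a v\<bar> ^ 3)"
  proof (rule average_mono)
    fix v
    show "cmod (iexp (x * a v) - T (x * a v)) \<le> (\<bar>x\<bar> ^ 3 / 6) * \<bar>a v\<bar> ^ 3"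
      using iexp_approx1[of "x * a v" 2, folded T_def]
      by (simp add: abs_mult power_mult_distrib fact_numeral)
  qed
  also have "\<dots> = average V (\<lambda>v. \<bar>a v\<bar> ^ 3) * \<bar>x\<bar> ^ 3 / 6"
    unfolding average_mult_left by simp
  finally have 1: "cmod (average V (\<lambda>v. iexp (x * a v)) - complex_of_real (1 - w * x\<^sup>2 / 2))
      \<le> average V (\<lambda>v. \<bar>a v\<bar> ^ 3) * \<bar>x\<bar> ^ 3 / 6"
    unfolding avT .
  define y where "y = w * x\<^sup>2 / 2"
  have "0 \<le> y" using \<open>0 \<le> w\<close> by (simp add: y_def)
  have "\<bar>(1 - y) - exp (- y)\<bar> \<le> y\<^sup>2 / 2"
    using \<open>0 \<le> y\<close> by (rule abs_one_minus_exp_le)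
  then have "cmod (complex_of_real (1 - y) - complex_of_real (exp (- y))) \<le> y\<^sup>2 / 2"
    unfolding of_real_diff[symmetric] norm_of_real .
  moreover have "y\<^sup>2 / 2 = (w * x\<^sup>2)\<^sup>2 / 8"
    by (simp add: y_def power_divide)
  ultimately have "cmod (average V (\<lambda>v. iexp (x * a v)) - complex_of_real (exp (- y)))
      \<le> average V (\<lambda>v. \<bar>a v\<bar> ^ 3) * \<bar>x\<bar> ^ 3 / 6 + (w * x\<^sup>2)\<^sup>2 / 8"
    using 1 norm_triangle_ineq[of "average V (\<lambda>v. iexp (x * a v)) - complex_of_real (1 - y)"
      "complex_of_real (1 - y) - complex_of_real (exp (- y))"] by (simp add: y_def)
  then show ?thesis
    by (simp add: y_def w_def flip: exp_of_real)
qed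

lemma cmod_iexp_diff_le: "cmod (iexp x - iexp y) \<le> \<bar>x - y\<bar>"
proof -
  have "iexp x - iexp y = iexp y * (iexp (x - y) - 1)"
    by (simp add: right_diff_distrib exp_diff)
  then have "cmod (iexp x - iexp y) = cmod (iexp (x - y) - 1)"
    by (simp add: norm_mult)
  also have "\<dots> \<le> \<bar>x - y\<bar>"
    using iexp_approx1[of "x - y" 0] by simp
  finally show ?thesis .
qed

lemma norm_mult_diff_le:
  fixes a b c d :: "'a::real_normed_algebra"
  assumes "norm b \<le> 1" "norm c \<le> 1"
  shows "norm (a * b - c * d) \<le> norm (a - c) + norm (b - d)"
proof -
  have "norm (a * b - c * d) = norm ((a - c) * b + c * (b - d))"
    by (simp add: algebra_simps)
  also have "\<dots> \<le> norm (a - c) * norm b + norm c * norm (b - d)"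
    by (intro norm_triangle_mono norm_mult_ineq)
  also have "\<dots> \<le> norm (a - c) * 1 + 1 * norm (b - d)"
    using assms by (intro add_mono mult_mono) auto
  finally show ?thesis by simp
qed

text \<open>The Gaussian factor is itself an \<open>m\<close>-th power, and \<open>m\<close>-th
  powers of numbers in the unit disc differ by at most \<open>m\<close> times their distance. At
  scale \<open>x = O(1 / sqrt m)\<close> the total error is \<open>O(1 / sqrt m)\<close>.\<close>

lemma average_iexp_power_approx:
  fixes a :: "'b \<Rightarrow> real"
  assumes V: "finite V" "V \<noteq> {}" and mean: "average V a = 0" and x: "\<bar>x\<bar> \<le> c / sqrt (real m)"
  shows "cmod (average V (\<lambda>v. iexp (x * a v)) ^ m
      - complex_of_real (exp (- (real m * (average V (\<lambda>v. (a v)\<^sup>2) * x\<^sup>2) / 2))))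
    \<le> real m * (average V (\<lambda>v. \<bar>a v\<bar> ^ 3) * (c / sqrt (real m)) ^ 3 / 6
      + (average V (\<lambda>v. (a v)\<^sup>2) * (c / sqrt (real m))\<^sup>2)\<^sup>2 / 8)"
proof -
  define w k where "w = average V (\<lambda>v. (a v)\<^sup>2)" and "k = average V (\<lambda>v. \<bar>a v\<bar> ^ 3)"
  have w: "0 \<le> w" and k: "0 \<le> k"
    unfolding w_def k_def by (auto intro!: average_nonneg)
  define \<psi> e where "\<psi> = average V (\<lambda>v. iexp (x * a v))" and "e = complex_of_real (exp (- (w * x\<^sup>2 / 2)))"
  have e: "complex_of_real (exp (- (real m * (w * x\<^sup>2) / 2))) = e ^ m"
    by (simp add: e_def flip: of_real_power exp_of_nat_mult)
  have "cmod (\<psi> ^ m - e ^ m) \<le> real m * cmod (\<psi> - e)"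
  proof (rule norm_power_diff)
    show "cmod \<psi> \<le> 1"
      unfolding \<psi>_def by (rule norm_average_le_1) simp
    show "cmod e \<le> 1"
      using w by (simp add: e_def)
  qed
  also have "cmod (\<psi> - e) \<le> k * \<bar>x\<bar> ^ 3 / 6 + (w * x\<^sup>2)\<^sup>2 / 8"
    using average_iexp_approx[OF V mean, of x] by (simp add: \<psi>_def e_def w_def k_def flip: exp_of_real)
  also have "\<dots> \<le> k * (c / sqrt (real m)) ^ 3 / 6 + (w * (c / sqrt (real m))\<^sup>2)\<^sup>2 / 8"
  proof -
    have "\<bar>x\<bar>\<^sup>2 \<le> (c / sqrt (real m))\<^sup>2"
      using x by (rule power_mono) simp
    then have "w * x\<^sup>2 \<le> w * (c / sqrt (real m))\<^sup>2"
      unfolding power2_abs using w by (rule mult_left_mono)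
    then have "(w * x\<^sup>2)\<^sup>2 \<le> (w * (c / sqrt (real m))\<^sup>2)\<^sup>2"
      using w by (intro power_mono) simp_all
    moreover have "k * \<bar>x\<bar> ^ 3 \<le> k * (c / sqrt (real m)) ^ 3"
      using k x by (intro mult_left_mono power_mono) auto
    ultimately show ?thesis
      by (intro add_mono divide_right_mono) auto
  qed
  finally show ?thesis
    unfolding w_def[symmetric] k_def[symmetric] \<psi>_def[symmetric] e by (simp add: mult_left_mono)
qed

section \<open>The number of entries as a bilinear statistic\<close>

text \<open>Thus \<open>gamma_set A\<close> is the probability that a uniform field element lies in
  \<open>A\<close>, minus the same probability for the constant 0.\<close>

lemma gamma_set_eq:
  fixes A :: "'a::{field,finite} set"
  shows "gamma_set A = real (card A) / real CARD('a) - of_bool (0 \<in> A)"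
proof -
  have "gamma_set A = (\<Sum>a\<in>A. 1 / real CARD('a) - of_bool (a = 0))"
    by (auto simp: gamma_set_def gamma_elem_def intro!: sum.cong)
  then show ?thesis
    by (simp add: sum_subtractf Groups_Big.sum.If_cases of_bool_def)
qed

text \<open>The proportion of \<open>A\<close> lies strictly between 0 and 1, so subtracting 0 or 1
  cannot give 0. This makes the variance positive.\<close>

lemma gamma_set_nonzero:
  fixes A :: "'a::{field,finite} set"
  assumes "A \<noteq> {}" "A \<subset> UNIV"
  shows "gamma_set A \<noteq> 0"
proof -
  have "0 < card A" "card A < CARD('a)"
    using assms by (auto simp: card_gt_0_iff intro: psubset_card_mono)
  then show ?thesis
    by (auto simp: gamma_set_eq field_simps of_bool_def split: if_splits)
qed

text \<open>With \<open>w \<bullet> v = 1\<close>, translation by multiples of \<open>w\<close> maps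
  the fibres of \<open>u \<mapsto> u \<bullet> v\<close> into one another, so all of them have the
  same size.\<close>

lemma card_scalar_prod_eq:
  fixes v :: "'a::{field,finite} vec"
  assumes v: "v \<in> carrier_vec r" "v \<noteq> 0\<^sub>v r"
  shows "CARD('a) * card {u \<in> carrier_vec r. u \<bullet> v = c} = card (carrier_vec r :: 'a vec set)"
proof -
  let ?F = "\<lambda>c. {u \<in> carrier_vec r. u \<bullet> v = c}"
  obtain k where k: "k < r" "v $ k \<noteq> 0"
    using v by (metis carrier_vecD eq_vecI index_zero_vec)
  define w where "w = (1 / v $ k) \<cdot>\<^sub>v unit_vec r k"
  have w: "w \<in> carrier_vec r" "w \<bullet> v = 1"
    using k v by (simp_all add: w_def scalar_prod_left_unit)
  have le: "card (?F c) \<le> card (?F d)" for c d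
  proof (rule card_inj_on_le[where f = "\<lambda>u. u + (d - c) \<cdot>\<^sub>v w"])
    show "inj_on (\<lambda>u. u + (d - c) \<cdot>\<^sub>v w) (?F c)"
      using w by (intro inj_on_inverseI[where g = "\<lambda>u. u - (d - c) \<cdot>\<^sub>v w"]) (auto intro!: eq_vecI)
    show "(\<lambda>u. u + (d - c) \<cdot>\<^sub>v w) ` ?F c \<subseteq> ?F d"
      using w v by (auto simp: add_scalar_prod_distrib[of _ r])
  qed auto
  have "card (carrier_vec r :: 'a vec set) = card (\<Union>d. ?F d)"
    by (rule arg_cong[of _ _ card]) auto
  also have "\<dots> = (\<Sum>d\<in>UNIV. card (?F d))"
    by (intro card_UN_disjoint) auto
  also have "\<dots> = (\<Sum>d\<in>(UNIV :: 'a set). card (?F c))"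
    by (intro sum.cong refl antisym le)
  finally show ?thesis
    by simp
qed

text \<open>The conditional probability given \<open>v\<close>: the scalar product is uniform if
  \<open>v\<close> is nonzero and constantly 0 otherwise.\<close>

lemma average_scalar_prod_mem:
  fixes A :: "'a::{field,finite} set"
  assumes v: "v \<in> carrier_vec r"
  shows "average (carrier_vec r) (\<lambda>u. of_bool (u \<bullet> v \<in> A) :: real)
    = real (card A) / real CARD('a) - gamma_set A * of_bool (v = 0\<^sub>v r)"
proof (cases "v = 0\<^sub>v r")
  case True
  have "average (carrier_vec r) (\<lambda>u. of_bool (u \<bullet> v \<in> A) :: real)
    = average (carrier_vec r :: 'a vec set) (\<lambda>u. of_bool (0 \<in> A))"
    using True by (intro average_cong) simp
  then show ?thesis
    using True by (simp add: average_const gamma_set_eq)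
next
  case False
  let ?V = "carrier_vec r :: 'a vec set"
  have "(\<Sum>u\<in>?V. of_bool (u \<bullet> v \<in> A) :: real) = (\<Sum>u\<in>?V. \<Sum>c\<in>A. of_bool (u \<bullet> v = c))"
    by (simp add: of_bool_def)
  also have "\<dots> = (\<Sum>c\<in>A. \<Sum>u\<in>?V. of_bool (u \<bullet> v = c))"
    by (rule sum.swap)
  also have "\<dots> = (\<Sum>c\<in>A. real (card ?V) / real CARD('a))"
  proof (rule sum.cong[OF refl])
    fix c
    have "real CARD('a) * real (card {u \<in> ?V. u \<bullet> v = c}) = real (card ?V)"
      using card_scalar_prod_eq[OF v False, of c] by (metis of_nat_mult)
    then have "real (card {u \<in> ?V. u \<bullet> v = c}) = real (card ?V) / real CARD('a)"
      by (simp add: field_simps)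
    then show "(\<Sum>u\<in>?V. of_bool (u \<bullet> v = c)) = real (card ?V) / real CARD('a)"
      by (simp add: of_bool_def sum.If_cases Int_def)
  qed
  finally show ?thesis
    using False by (simp add: average_def)
qed

text \<open>The two parts of the Hoeffding decomposition of the indicator of \<open>u \<bullet> v \<in> A\<close>.\<close>

definition lin_part :: "'a::{field,finite} set \<Rightarrow> nat \<Rightarrow> 'a vec \<Rightarrow> real" where
  "lin_part A r v = gamma_set A * ((1 / real CARD('a)) ^ r - of_bool (v = 0\<^sub>v r))"

definition degen_part :: "'a::{field,finite} set \<Rightarrow> nat \<Rightarrow> 'a vec \<Rightarrow> 'a vec \<Rightarrow> real" where
  "degen_part A r u v = of_bool (u \<bullet> v \<in> A)
     - (real (card A) / real CARD('a) - gamma_set A * (1 / real CARD('a)) ^ r)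
     - lin_part A r u - lin_part A r v"

lemma average_zero_vec:
  "average (carrier_vec r) (\<lambda>v :: 'a::{field,finite} vec. of_bool (v = 0\<^sub>v r) :: real) = (1 / real CARD('a)) ^ r"
proof -
  have "{v \<in> carrier_vec r. v = 0\<^sub>v r} = {0\<^sub>v r :: 'a vec}"
    by auto
  then show ?thesis
    by (simp add: average_def card_carrier_vec of_bool_def sum.If_cases Int_def power_one_over inverse_eq_divide)
qed

lemma average_lin_part: "average (carrier_vec r) (lin_part A r) = 0"
  unfolding lin_part_def[abs_def] average_mult_left average_diff
  by (simp add: average_const average_zero_vec)

text \<open>Up to the factor \<open>gamma_set A\<close>, this is the variance of an indicator of
  probability \<open>p\<close>. It is the coefficient of \<open>(m + n) m n\<close> in
  \<open>sigma2\<close>.\<close>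

lemma average_lin_part_square:
  fixes A :: "'a::{field,finite} set" and r :: nat
  defines "p \<equiv> (1 / real CARD('a)) ^ r"
  shows "average (carrier_vec r) (\<lambda>v. (lin_part A r v)\<^sup>2) = (gamma_set A)\<^sup>2 * p * (1 - p)"
proof -
  have "(lin_part A r v)\<^sup>2 = (gamma_set A)\<^sup>2 * (p\<^sup>2 + (1 - 2 * p) * of_bool (v = 0\<^sub>v r))" for v
    by (simp add: lin_part_def p_def[symmetric] power_mult_distrib power2_diff)
  then have "average (carrier_vec r) (\<lambda>v. (lin_part A r v)\<^sup>2) = (gamma_set A)\<^sup>2 * (p\<^sup>2 + (1 - 2 * p) * p)"
    by (simp only: average_mult_left average_add average_zero_vec p_def[symmetric]) (simp add: average_const)
  then show ?thesis
    by (simp add: power2_eq_square algebra_simps)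
qed

text \<open>The linear part at \<open>v\<close> is exactly the deviation of the conditional mean
  given \<open>v\<close> from the overall mean, so subtracting it leaves conditional mean 0.\<close>

lemma average_degen_part:
  assumes v: "v \<in> carrier_vec r"
  shows "average (carrier_vec r) (\<lambda>u. degen_part A r u v) = 0"
    and "average (carrier_vec r) (degen_part A r v) = 0"
proof -
  show 1: "average (carrier_vec r) (\<lambda>u. degen_part A r u v) = 0"
    unfolding degen_part_def average_diff average_scalar_prod_mem[OF v]
    by (simp add: average_const average_lin_part) (simp add: lin_part_def algebra_simps)
  have "average (carrier_vec r) (degen_part A r v) = average (carrier_vec r) (\<lambda>u. degen_part A r u v)"
    using v by (intro average_cong) (simp add: degen_part_def comm_scalar_prod[of v r])
  with 1 show "average (carrier_vec r) (degen_part A r v) = 0"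
    by simp
qed

text \<open>Entry \<open>(i, j)\<close> of the product is \<open>row P i \<bullet> row Q j\<close>.
  In the double sum, the linear part of a row of \<open>P\<close> is repeated \<open>n\<close> times
  and that of a row of \<open>Q\<close> is repeated \<open>m\<close> times.\<close>

lemma count_entries_mult_transpose:
  fixes A :: "'a::{field,finite} set"
  assumes P: "P \<in> carrier_mat m r" and Q: "Q \<in> carrier_mat n r"
  shows "real (count_entries A (P * Q\<^sup>T)) - mu A r m n
    = real n * (\<Sum>i<m. lin_part A r (row P i)) + real m * (\<Sum>j<n. lin_part A r (row Q j))
      + (\<Sum>i<m. \<Sum>j<n. degen_part A r (row P i) (row Q j))"
proof -
  define c where "c = real (card A) / real CARD('a) - gamma_set A * (1 / real CARD('a)) ^ r"
  have "{(i, j). i < dim_row (P * Q\<^sup>T) \<and> j < dim_col (P * Q\<^sup>T) \<and> (P * Q\<^sup>T) $$ (i, j) \<in> A}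
      = (SIGMA i:{..<m}. {j \<in> {..<n}. row P i \<bullet> row Q j \<in> A})"
    using P Q by auto
  then have "real (count_entries A (P * Q\<^sup>T)) = (\<Sum>i<m. \<Sum>j<n. of_bool (row P i \<bullet> row Q j \<in> A))"
    by (simp add: count_entries_def of_bool_def sum.If_cases Int_def)
  also have "\<dots> = (\<Sum>i<m. \<Sum>j<n. c + lin_part A r (row P i) + lin_part A r (row Q j)
      + degen_part A r (row P i) (row Q j))"
    by (simp add: degen_part_def c_def)
  also have "\<dots> = c * real m * real n + real n * (\<Sum>i<m. lin_part A r (row P i))
      + real m * (\<Sum>j<n. lin_part A r (row Q j))
      + (\<Sum>i<m. \<Sum>j<n. degen_part A r (row P i) (row Q j))"
    by (simp add: sum.distrib sum_distrib_left algebra_simps)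
  finally show ?thesis
    by (simp add: mu_def c_def)
qed

section \<open>Passing from matrices of rank \<open>r\<close> to pairs of factors\<close>

lemma left_invertible_mats_nonempty: "r \<le> m \<Longrightarrow> left_invertible_mats m r \<noteq> ({} :: 'a::field mat set)"
proof -
  assume "r \<le> m"
  define P :: "'a mat" where "P = mat m r (\<lambda>(i, j). of_bool (i = j))"
  have "P \<in> left_invertible_mats m r"
  proof (rule left_invertible_if_unit_rows)
    fix j assume "j < r"
    then show "\<exists>i<m. row P i = unit_vec r j"
      using \<open>r \<le> m\<close> by (intro exI[of _ j]) (auto simp: P_def unit_vec_def)
  qed (simp add: P_def)
  then show ?thesis by blast
qed

text \<open>All fibres of \<open>(P, Q) \<mapsto> P * Q\<^sup>T\<close> over the matrices of rank
  \<open>r\<close> have the same size \<open>k\<close>, so the product of a uniform full-rank pair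
  is uniform.\<close>

lemma average_rank_mats:
  fixes f :: "'a::{field,finite} mat \<Rightarrow> 'c::real_vector"
  shows "average (rank_mats r m n) f
    = average (left_invertible_mats m r \<times> left_invertible_mats n r) (\<lambda>(P, Q). f (P * Q\<^sup>T))"
proof -
  let ?F = "left_invertible_mats m r \<times> left_invertible_mats n r :: ('a mat \<times> 'a mat) set"
  define k where "k = card (inverse_pairs r :: ('a mat \<times> 'a mat) set)"
  have finR: "finite (rank_mats r m n :: 'a mat set)"
    by (rule finite_subset[of _ "carrier_mat m n"]) (auto simp: rank_mats_def)
  have fin: "finite ?F"
    by (rule finite_subset[of _ "carrier_mat m r \<times> carrier_mat n r"]) (auto simp: left_invertible_mats_def)
  have "(1\<^sub>m r, 1\<^sub>m r) \<in> (inverse_pairs r :: ('a mat \<times> 'a mat) set)"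
    by (simp add: inverse_pairs_def)
  moreover have "finite (inverse_pairs r :: ('a mat \<times> 'a mat) set)"
    by (rule finite_subset[of _ "carrier_mat r r \<times> carrier_mat r r"]) (auto simp: inverse_pairs_def)
  ultimately have k: "0 < k"
    by (auto simp: k_def card_gt_0_iff)
  have img: "(\<lambda>x. case x of (P, Q) \<Rightarrow> P * Q\<^sup>T) ` ?F \<subseteq> rank_mats r m n"
  proof clarify
    fix P Q :: "'a mat" assume "P \<in> left_invertible_mats m r" "Q \<in> left_invertible_mats n r"
    then show "P * Q\<^sup>T \<in> rank_mats r m n"
      using rank_mats_factorization[of "P * Q\<^sup>T" r m n] by blast
  qed
  have sum: "(\<Sum>x\<in>?F. case x of (P, Q) \<Rightarrow> g (P * Q\<^sup>T)) = real k *\<^sub>R sum g (rank_mats r m n)"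
    for g :: "'a mat \<Rightarrow> 'd::real_vector"
  proof -
    have "(\<Sum>x\<in>?F. case x of (P, Q) \<Rightarrow> g (P * Q\<^sup>T))
        = (\<Sum>N\<in>rank_mats r m n. \<Sum>x\<in>{x \<in> ?F. (case x of (P, Q) \<Rightarrow> P * Q\<^sup>T) = N}. case x of (P, Q) \<Rightarrow> g (P * Q\<^sup>T))"
      by (rule sum.group[symmetric]) (rule fin finR img)+
    also have "\<dots> = (\<Sum>N\<in>rank_mats r m n. real k *\<^sub>R g N)"
    proof (rule sum.cong[OF refl])
      fix N :: "'a mat" assume N: "N \<in> rank_mats r m n"
      define E where "E = {(P, Q) \<in> ?F. P * Q\<^sup>T = N}"
      have "(\<Sum>x\<in>E. case x of (P, Q) \<Rightarrow> g (P * Q\<^sup>T)) = (\<Sum>x\<in>E. g N)"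
        by (rule sum.cong) (auto simp: E_def)
      also have "\<dots> = real k *\<^sub>R g N"
        using card_rank_factorizations[OF N] by (simp add: sum_constant_scaleR k_def E_def)
      also have "E = {x \<in> ?F. (case x of (P, Q) \<Rightarrow> P * Q\<^sup>T) = N}"
        by (auto simp: E_def)
      finally show "(\<Sum>x\<in>{x \<in> ?F. (case x of (P, Q) \<Rightarrow> P * Q\<^sup>T) = N}. case x of (P, Q) \<Rightarrow> g (P * Q\<^sup>T)) = real k *\<^sub>R g N" .
    qed
    finally show ?thesis
      by (simp add: scaleR_right.sum)
  qed
  \<comment> \<open>The constant function 1 compares the cardinalities; after that the factor
    \<open>k\<close> cancels.\<close>
  have "real (card ?F) = real k * real (card (rank_mats r m n :: 'a mat set))"
    using sum[of "\<lambda>_. 1 :: real"] by (simp add: split_def)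
  then show ?thesis
    using k by (simp add: average_def sum[of f])
qed

text \<open>Without a left inverse, some unit vector is missing among the rows. Each one is missed
  by \<open>m\<close> independent uniform rows with probability \<open>(1 - p)^m\<close>, where
  \<open>p = q^(-r)\<close>, and there are \<open>r\<close> of them.\<close>

lemma card_not_left_invertible_le:
  "real (card (carrier_mat m r - left_invertible_mats m r :: 'a::{field,finite} mat set))
    / real (card (carrier_mat m r :: 'a mat set)) \<le> real r * (1 - (1 / real CARD('a)) ^ r) ^ m"
proof -
  let ?M = "carrier_mat m r :: 'a mat set" and ?V = "carrier_vec r :: 'a vec set"
  define B where "B j = {P \<in> ?M. \<forall>i<m. row P i \<noteq> unit_vec r j}" for j
  have "?M - left_invertible_mats m r \<subseteq> (\<Union>j<r. B j)"
  proof
    fix P assume P: "P \<in> ?M - left_invertible_mats m r"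
    then obtain j where "j < r" "\<forall>i<m. row P i \<noteq> unit_vec r j"
      using left_invertible_if_unit_rows[of P m r] by auto
    with P show "P \<in> (\<Union>j<r. B j)"
      by (auto simp: B_def)
  qed
  then have "card (?M - left_invertible_mats m r) \<le> card (\<Union>j<r. B j)"
    by (intro card_mono) (auto simp: B_def)
  also have "\<dots> \<le> (\<Sum>j<r. card (B j))"
    by (rule card_UN_le) simp
  also have "\<dots> = (\<Sum>j<r. (card ?V - 1) ^ m)"
  proof (rule sum.cong[OF refl])
    fix j
    \<comment> \<open>The condition on all rows becomes a product of indicators, as
      \<open>sum_rows_prod\<close> requires.\<close>
    have of_bool_all: "(\<Prod>i<l. of_bool (Q i) :: nat) = of_bool (\<forall>i<l. Q i)" for l :: nat and Q
      by (induction l) (auto simp: less_Suc_eq)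
    have "card (B j) = (\<Sum>P\<in>?M. of_bool (\<forall>i<m. row P i \<noteq> unit_vec r j))"
      by (simp add: B_def of_bool_def sum.If_cases Int_def)
    also have "\<dots> = (\<Sum>P\<in>?M. \<Prod>i<m. of_bool (row P i \<noteq> unit_vec r j))"
      unfolding of_bool_all ..
    also have "\<dots> = (\<Prod>i<m. \<Sum>v\<in>?V. of_bool (v \<noteq> unit_vec r j))"
      by (rule sum_rows_prod)
    also have "(\<Sum>v\<in>?V. of_bool (v \<noteq> unit_vec r j)) = card (?V - {unit_vec r j})"
      by (simp add: of_bool_def sum.If_cases Int_def set_diff_eq)
    finally show "card (B j) = (card ?V - 1) ^ m"
      by (simp add: card_Diff_singleton)
  qed
  also have "\<dots> = r * (card ?V - 1) ^ m"
    by simp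
  finally have "real (card (?M - left_invertible_mats m r)) \<le> real (r * (card ?V - 1) ^ m)"
    using of_nat_mono by blast
  also have "\<dots> = real r * (real (card ?V) - 1) ^ m"
    using card_carrier_vec_pos[of r, where 'a = 'a] by (simp add: of_nat_diff del: card_carrier_vec_pos)
  finally have "real (card (?M - left_invertible_mats m r)) / real (card ?M)
      \<le> real r * (real (card ?V) - 1) ^ m / real (card ?M)"
    by (rule divide_right_mono) simp
  also have "\<dots> = real r * ((real (card ?V) - 1) / real (card ?V)) ^ m"
    by (simp add: card_carrier_mat power_divide)
  also have "(real (card ?V) - 1) / real (card ?V) = 1 - (1 / real CARD('a)) ^ r"
    by (simp add: card_carrier_vec diff_divide_distrib power_one_over)
  finally show ?thesis .
qed

lemma card_not_both_left_invertible_le: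
  fixes m n r :: nat
  defines "T \<equiv> carrier_mat m r \<times> carrier_mat n r :: ('a::{field,finite} mat \<times> 'a mat) set"
  shows "real (card (T - left_invertible_mats m r \<times> left_invertible_mats n r)) / real (card T)
    \<le> real r * (1 - (1 / real CARD('a)) ^ r) ^ m + real r * (1 - (1 / real CARD('a)) ^ r) ^ n"
proof -
  let ?M = "carrier_mat m r :: 'a mat set" and ?N = "carrier_mat n r :: 'a mat set"
  let ?M' = "?M - left_invertible_mats m r" and ?N' = "?N - left_invertible_mats n r"
  have "card (T - left_invertible_mats m r \<times> left_invertible_mats n r) \<le> card (?M' \<times> ?N \<union> ?M \<times> ?N')"
    by (rule card_mono) (auto simp: T_def)
  also have "\<dots> \<le> card ?M' * card ?N + card ?M * card ?N'"
    using card_Un_le[of "?M' \<times> ?N" "?M \<times> ?N'"] by (simp add: card_cartesian_product)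
  finally have "real (card (T - left_invertible_mats m r \<times> left_invertible_mats n r))
      \<le> real (card ?M') * real (card ?N) + real (card ?M) * real (card ?N')"
    by (metis of_nat_add of_nat_le_iff of_nat_mult)
  then have "real (card (T - left_invertible_mats m r \<times> left_invertible_mats n r)) / real (card T)
      \<le> (real (card ?M') * real (card ?N) + real (card ?M) * real (card ?N')) / real (card T)"
    by (rule divide_right_mono) simp
  also have "\<dots> = real (card ?M') / real (card ?M) + real (card ?N') / real (card ?N)"
    by (simp add: T_def card_cartesian_product add_divide_distrib)
  also have "\<dots> \<le> real r * (1 - (1 / real CARD('a)) ^ r) ^ m + real r * (1 - (1 / real CARD('a)) ^ r) ^ n"
    by (intro add_mono card_not_left_invertible_le)
  finally show ?thesis .
qed

section \<open>Convergence of characteristic functions\<close>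

lemma char_distr_pmf_of_set:
  assumes "finite S" "S \<noteq> {}"
  shows "char (distr (measure_pmf (pmf_of_set S)) borel Z) t = average S (\<lambda>x. iexp (t * Z x))"
proof -
  have "char (distr (measure_pmf (pmf_of_set S)) borel Z) t
      = (\<integral>x. iexp (t * Z x) \<partial>measure_pmf (pmf_of_set S))"
    unfolding char_def by (subst integral_distr) auto
  also have "\<dots> = (\<Sum>x\<in>S. pmf (pmf_of_set S) x *\<^sub>R iexp (t * Z x))"
    using assms by (intro integral_measure_pmf) auto
  also have "\<dots> = average S (\<lambda>x. iexp (t * Z x))"
    using assms by (simp add: average_def scaleR_right.sum inverse_eq_divide)
  finally show ?thesis .
qed

text \<open>The summands account for the matrices without a left inverse, for the degenerate part, and for the
  cubic remainder in the expansion of the characteristic function of the linear part.\<close>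

definition err_bound :: "'a::{field,finite} set \<Rightarrow> nat \<Rightarrow> real \<Rightarrow> nat \<Rightarrow> real" where
  "err_bound A r t m =
    (let p = (1 / real CARD('a)) ^ r;
         w = average (carrier_vec r) (\<lambda>v. (lin_part A r v)\<^sup>2);
         c = \<bar>t\<bar> / sqrt w
     in 2 * (real r * (1 - p) ^ m)
      + sqrt (c\<^sup>2 * average (carrier_vec r) (\<lambda>u. average (carrier_vec r) (\<lambda>v. (degen_part A r u v)\<^sup>2)) / real m)
      + real m * (average (carrier_vec r) (\<lambda>v. \<bar>lin_part A r v\<bar> ^ 3) * (c / sqrt (real m)) ^ 3 / 6
        + (w * (c / sqrt (real m))\<^sup>2)\<^sup>2 / 8))"

lemma err_bound_tendsto_0:
  fixes A :: "'a::{field,finite} set"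
  shows "err_bound A r t \<longlonglongrightarrow> 0"
proof -
  define p where "p = (1 / real CARD('a)) ^ r"
  define w where "w = average (carrier_vec r) (\<lambda>v. (lin_part A r v)\<^sup>2)"
  define c where "c = \<bar>t\<bar> / sqrt w"
  define H where "H = average (carrier_vec r) (\<lambda>u. average (carrier_vec r) (\<lambda>v. (degen_part A r u v)\<^sup>2))"
  define K where "K = average (carrier_vec r) (\<lambda>v. \<bar>lin_part A r v\<bar> ^ 3)"
  have p: "0 < p" "p \<le> 1"
    by (auto simp: p_def power_le_one_iff)
  have "(\<lambda>m. 2 * (real r * (1 - p) ^ m)) \<longlonglongrightarrow> 0"
    using p by (intro tendsto_mult_right_zero LIMSEQ_power_zero) auto
  moreover have "(\<lambda>m. sqrt (c\<^sup>2 * H / real m)) \<longlonglongrightarrow> sqrt 0"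
    by (intro tendsto_real_sqrt lim_const_over_n)
  moreover have "(\<lambda>m. real m * (K * (c / sqrt (real m)) ^ 3 / 6 + (w * (c / sqrt (real m))\<^sup>2)\<^sup>2 / 8)) \<longlonglongrightarrow> 0"
  proof -
    \<comment> \<open>With the constants taken out, the two terms are of order
      \<open>1 / sqrt m\<close> and \<open>1 / m\<close>.\<close>
    have "(\<lambda>m. K * c ^ 3 / 6 * (real m * (1 / sqrt (real m)) ^ 3)
        + w\<^sup>2 * c ^ 4 / 8 * (real m * (1 / real m)\<^sup>2)) \<longlonglongrightarrow> 0"
      by (intro tendsto_add_zero tendsto_mult_right_zero) real_asymp+
    then show ?thesis
      by (simp add: power_divide power_mult_distrib distrib_left mult_ac flip: power_mult)
  qed
  ultimately have "(\<lambda>m. 2 * (real r * (1 - p) ^ m) + sqrt (c\<^sup>2 * H / real m)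
      + real m * (K * (c / sqrt (real m)) ^ 3 / 6 + (w * (c / sqrt (real m))\<^sup>2)\<^sup>2 / 8)) \<longlonglongrightarrow> 0 + sqrt 0 + 0"
    by (intro tendsto_add)
  then show ?thesis
    by (simp add: err_bound_def[abs_def] Let_def p_def w_def c_def H_def K_def)
qed

text \<open>Full-rank pairs are replaced by all pairs (1), the degenerate part is dropped (2), the
  rest factorizes over the independent rows (3), and each power is compared with a Gaussian (4). The
  bound separates \<open>m\<close> from \<open>n\<close>, so it tends to 0 in the double
  limit.\<close>

lemma char_rank_mat_approx:
  fixes A :: "'a::{field,finite} set"
  assumes r: "0 < r" and A: "A \<noteq> {}" "A \<subset> UNIV" and mn: "r \<le> m" "r \<le> n"
  shows "cmod (char (distr (measure_pmf (uniform_rank_mat r m n)) borel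
      (\<lambda>N. (real (count_entries A N) - mu A r m n) / sqrt (sigma2 A r m n))) t
      - complex_of_real (exp (- t\<^sup>2 / 2))) \<le> err_bound A r t m + err_bound A r t n"
proof -
  let ?V = "carrier_vec r :: 'a vec set"
  define p where "p = (1 / real CARD('a)) ^ r"
  define w where "w = average ?V (\<lambda>v. (lin_part A r v)\<^sup>2)"
  define c where "c = \<bar>t\<bar> / sqrt w"
  define H where "H = average ?V (\<lambda>u. average ?V (\<lambda>v. (degen_part A r u v)\<^sup>2))"
  define K where "K = average ?V (\<lambda>v. \<bar>lin_part A r v\<bar> ^ 3)"
  define \<sigma> where "\<sigma> = sqrt (sigma2 A r m n)"
  have m: "0 < m" and n: "0 < n"
    using r mn by auto
  have q: "1 < real CARD('a)"
    using card_mono[of UNIV "{0, 1 :: 'a}"] by simp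
  have p: "0 < p" "p < 1"
    using q r by (auto simp: p_def power_less_one_iff)
  have w_eq: "w = (gamma_set A)\<^sup>2 * p * (1 - p)"
    by (simp add: w_def p_def average_lin_part_square)
  have w: "0 < w"
    using p gamma_set_nonzero[OF A] by (simp add: w_eq)
  have \<sigma>: "\<sigma> = sqrt (w * ((real m + real n) * real m * real n))"
    by (simp add: \<sigma>_def sigma2_def w_eq p_def mult.assoc)
  have \<sigma>2: "\<sigma>\<^sup>2 = w * ((real m + real n) * real m * real n)"
    using w by (simp add: \<sigma>)
  have \<sigma>_pos: "0 < \<sigma>"
    using w m n by (simp add: \<sigma>)
  have H: "0 \<le> H"
    by (auto simp: H_def intro!: average_nonneg)

  let ?S = "left_invertible_mats m r \<times> left_invertible_mats n r :: ('a mat \<times> 'a mat) set"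
  define T where "T = (carrier_mat m r \<times> carrier_mat n r :: ('a mat \<times> 'a mat) set)"
  define Z where "Z N = (real (count_entries A N) - mu A r m n) / \<sigma>" for N :: "'a mat"
  define R where "R P Q = (\<Sum>i<m. \<Sum>j<n. degen_part A r (row P i) (row Q j))" for P Q
  \<comment> \<open>The factors that \<open>t / \<sigma>\<close> gives to the linear parts of the
    rows of \<open>P\<close> and of \<open>Q\<close>.\<close>
  define x y where "x = t * real n / \<sigma>" and "y = t * real m / \<sigma>"
  define L1 where "L1 P = (\<Prod>i<m. iexp (x * lin_part A r (row P i)))" for P
  define L2 where "L2 Q = (\<Prod>j<n. iexp (y * lin_part A r (row Q j)))" for Q
  define \<psi> where "\<psi> x = average ?V (\<lambda>v. iexp (x * lin_part A r v))" for x
  define G where "G k = real k * (K * (c / sqrt (real k)) ^ 3 / 6 + (w * (c / sqrt (real k))\<^sup>2)\<^sup>2 / 8)" for k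

  have finT: "finite T" and T_ne: "T \<noteq> {}"
    by (simp_all add: T_def)
  have S_ne: "?S \<noteq> {}"
    using left_invertible_mats_nonempty[OF mn(1)] left_invertible_mats_nonempty[OF mn(2)] by blast
  have ST: "?S \<subseteq> T"
    by (auto simp: T_def left_invertible_mats_def)
  have finR: "finite (rank_mats r m n :: 'a mat set)"
    by (rule finite_subset[of _ "carrier_mat m n"]) (auto simp: rank_mats_def)
  have R_ne: "rank_mats r m n \<noteq> ({} :: 'a mat set)"
    using S_ne rank_mats_factorization by blast

  have char_eq: "char (distr (measure_pmf (uniform_rank_mat r m n)) borel
      (\<lambda>N. (real (count_entries A N) - mu A r m n) / sqrt (sigma2 A r m n))) t
      = average ?S (\<lambda>(P, Q). iexp (t * Z (P * Q\<^sup>T)))"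
    using char_distr_pmf_of_set[OF finR R_ne, of Z t] average_rank_mats[of r m n "\<lambda>N. iexp (t * Z N)"]
    by (simp add: uniform_rank_mat_def Z_def[abs_def] \<sigma>_def)

  have Z_eq: "iexp (t * Z (P * Q\<^sup>T)) = iexp (\<Sum>i<m. x * lin_part A r (row P i)) * iexp (\<Sum>j<n. y * lin_part A r (row Q j)) * iexp (t * R P Q / \<sigma>)"
    if "(P, Q) \<in> T" for P Q
  proof -
    have "t * Z (P * Q\<^sup>T) = (\<Sum>i<m. x * lin_part A r (row P i)) + (\<Sum>j<n. y * lin_part A r (row Q j)) + t * R P Q / \<sigma>"
      using that count_entries_mult_transpose[of P m r Q n A]
      by (simp add: T_def Z_def R_def x_def y_def add_divide_distrib distrib_left mult_ac
        sum_distrib_left sum_divide_distrib)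
    then show ?thesis
      by (simp only: of_real_add distrib_left exp_add)
  qed
  have L_eq: "L1 P = iexp (\<Sum>i<m. x * lin_part A r (row P i))" "L2 Q = iexp (\<Sum>j<n. y * lin_part A r (row Q j))" for P Q
    by (simp_all add: L1_def L2_def exp_sum sum_distrib_left)

  have 1: "cmod (average ?S (\<lambda>(P, Q). iexp (t * Z (P * Q\<^sup>T))) - average T (\<lambda>(P, Q). iexp (t * Z (P * Q\<^sup>T))))
      \<le> 2 * (real r * (1 - p) ^ m) + 2 * (real r * (1 - p) ^ n)"
  proof -
    have "cmod (average ?S (\<lambda>(P, Q). iexp (t * Z (P * Q\<^sup>T))) - average T (\<lambda>(P, Q). iexp (t * Z (P * Q\<^sup>T))))
        \<le> 2 * (real (card (T - ?S)) / real (card T))"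
      by (rule norm_average_subset_diff_le[OF finT ST S_ne]) auto
    also have "\<dots> \<le> 2 * (real r * (1 - p) ^ m + real r * (1 - p) ^ n)"
      using card_not_both_left_invertible_le[of m r n, where 'a = 'a] by (simp add: T_def p_def)
    finally show ?thesis by simp
  qed

  have 2: "cmod (average T (\<lambda>(P, Q). iexp (t * Z (P * Q\<^sup>T))) - average T (\<lambda>(P, Q). L1 P * L2 Q))
      \<le> sqrt (c\<^sup>2 * H / real m)"
  proof -
    have "cmod (average T (\<lambda>(P, Q). iexp (t * Z (P * Q\<^sup>T))) - average T (\<lambda>(P, Q). L1 P * L2 Q))
        \<le> average T (\<lambda>z. cmod ((case z of (P, Q) \<Rightarrow> iexp (t * Z (P * Q\<^sup>T))) - (case z of (P, Q) \<Rightarrow> L1 P * L2 Q)))"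
      unfolding average_diff[symmetric] by (rule norm_average_le)
    also have "\<dots> \<le> average T (\<lambda>(P, Q). \<bar>t * R P Q / \<sigma>\<bar>)"
    \<comment> \<open>The exponentials of the linear parts have modulus 1, so only the exponential
      of the degenerate part is compared with 1.\<close>
    proof (rule average_mono, clarify)
      fix P Q assume "(P, Q) \<in> T"
      have "iexp (t * Z (P * Q\<^sup>T)) - L1 P * L2 Q = L1 P * L2 Q * (iexp (t * R P Q / \<sigma>) - iexp 0)"
        unfolding Z_eq[OF \<open>(P, Q) \<in> T\<close>] L_eq by (simp add: right_diff_distrib)
      then have "cmod (iexp (t * Z (P * Q\<^sup>T)) - L1 P * L2 Q) = cmod (iexp (t * R P Q / \<sigma>) - iexp 0)"
        by (simp add: norm_mult L_eq)
      also have "\<dots> \<le> \<bar>t * R P Q / \<sigma>\<bar>"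
        using cmod_iexp_diff_le[of "t * R P Q / \<sigma>" 0] by simp
      finally show "cmod (iexp (t * Z (P * Q\<^sup>T)) - L1 P * L2 Q) \<le> \<bar>t * R P Q / \<sigma>\<bar>" .
    qed
    also have "\<dots> \<le> sqrt (c\<^sup>2 * H / real m)"
    proof (rule real_le_rsqrt)
      have "(average T (\<lambda>(P, Q). \<bar>t * R P Q / \<sigma>\<bar>))\<^sup>2 \<le> average T (\<lambda>z. (case z of (P, Q) \<Rightarrow> \<bar>t * R P Q / \<sigma>\<bar>)\<^sup>2)"
        by (rule average_square_le)
      also have "\<dots> = average T (\<lambda>z. (t / \<sigma>)\<^sup>2 * (case z of (P, Q) \<Rightarrow> (R P Q)\<^sup>2))"
        by (rule average_cong) (auto simp: power_mult_distrib power_divide)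
      also have "\<dots> = (t / \<sigma>)\<^sup>2 * average T (\<lambda>(P, Q). (R P Q)\<^sup>2)"
        by (rule average_mult_left)
      also have "average T (\<lambda>(P, Q). (R P Q)\<^sup>2) = real m * real n * H"
        unfolding T_def R_def H_def by (rule average_bilinear_square) (rule average_degen_part; assumption)+
      \<comment> \<open>The variance \<open>m n H\<close> is divided by
        \<open>\<sigma>^2 = w (m + n) m n\<close>; this is why the degenerate part is
        negligible.\<close>
      also have "(t / \<sigma>)\<^sup>2 * (real m * real n * H) = c\<^sup>2 * H / (real m + real n)"
        using w m n by (simp add: power_divide \<sigma>2 c_def)
      also have "\<dots> \<le> c\<^sup>2 * H / real m"
        using H m by (intro divide_left_mono) auto
      finally show "(average T (\<lambda>(P, Q). \<bar>t * R P Q / \<sigma>\<bar>))\<^sup>2 \<le> c\<^sup>2 * H / real m" .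
    qed
    finally show ?thesis .
  qed

  have 3: "average T (\<lambda>(P, Q). L1 P * L2 Q) = \<psi> x ^ m * \<psi> y ^ n"
    unfolding T_def average_mult_Times L1_def L2_def \<psi>_def
      average_rows_prod[where g = "\<lambda>v. iexp (x * lin_part A r v)"]
      average_rows_prod[where g = "\<lambda>v. iexp (y * lin_part A r v)"] ..

  have 4: "cmod (\<psi> x ^ m * \<psi> y ^ n - complex_of_real (exp (- t\<^sup>2 / 2))) \<le> G m + G n"
  proof -
    define e1 e2 where "e1 = complex_of_real (exp (- (real m * (w * x\<^sup>2) / 2)))"
      and "e2 = complex_of_real (exp (- (real n * (w * y\<^sup>2) / 2)))"
    have approx: "cmod (\<psi> z ^ k - complex_of_real (exp (- (real k * (w * z\<^sup>2) / 2)))) \<le> G k"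
      if "\<bar>z\<bar> \<le> c / sqrt (real k)" for z k
      unfolding \<psi>_def w_def K_def G_def
      by (rule average_iexp_power_approx[OF finite_carrier_vec carrier_vec_nonempty average_lin_part that])
    \<comment> \<open>This is \<open>k l^2 \<le> (k + l) k l\<close>. It is stated for general
      \<open>k\<close>, \<open>l\<close> to cover \<open>x\<close> with \<open>(m, n)\<close> and
      \<open>y\<close> with \<open>(n, m)\<close>.\<close>
    have le: "\<bar>t * real l / \<sigma>\<bar> \<le> c / sqrt (real k)"
      if kl: "0 < k" "0 < l" "\<sigma> = sqrt (w * ((real k + real l) * real k * real l))" for k l :: nat
    proof -
      have "sqrt w * sqrt (real k) * real l = sqrt (w * (real k * (real l)\<^sup>2))"
        by (simp add: real_sqrt_mult)
      also have "\<dots> \<le> \<sigma>"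
        unfolding kl(3) using w by (intro real_sqrt_le_mono mult_left_mono) (auto simp: power2_eq_square algebra_simps)
      finally have "\<bar>t\<bar> * (sqrt w * sqrt (real k) * real l) \<le> \<bar>t\<bar> * \<sigma>"
        by (rule mult_left_mono) simp
      then show ?thesis
        using w kl(1,2) \<sigma>_pos by (simp add: c_def abs_mult abs_divide field_simps)
    qed
    have "cmod (\<psi> x ^ m - e1) \<le> G m"
      unfolding e1_def by (rule approx) (use le[of m n] m n \<sigma> in \<open>simp add: x_def\<close>)
    moreover have "cmod (\<psi> y ^ n - e2) \<le> G n"
      unfolding e2_def by (rule approx) (use le[of n m] m n \<sigma> in \<open>simp add: y_def mult_ac add_ac\<close>)
    moreover have "e1 * e2 = complex_of_real (exp (- t\<^sup>2 / 2))"
    proof -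
      \<comment> \<open>The two Gaussian exponents add up because
        \<open>m n^2 + n m^2 = (m + n) m n\<close>.\<close>
      have "real m * (w * x\<^sup>2) + real n * (w * y\<^sup>2) = t\<^sup>2"
        using w m n by (simp add: x_def y_def power_divide power_mult_distrib \<sigma>2 divide_simps)
          (simp add: power2_eq_square algebra_simps)
      then have "- (real m * (w * x\<^sup>2) / 2) + - (real n * (w * y\<^sup>2) / 2) = - t\<^sup>2 / 2"
        by simp
      then show ?thesis
        unfolding e1_def e2_def of_real_mult[symmetric] exp_add[symmetric] by simp
    qed
    moreover have "cmod (\<psi> x ^ m * \<psi> y ^ n - e1 * e2) \<le> cmod (\<psi> x ^ m - e1) + cmod (\<psi> y ^ n - e2)"
    proof (rule norm_mult_diff_le)
      have "cmod (\<psi> y) \<le> 1"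
        unfolding \<psi>_def by (rule norm_average_le_1) simp
      then show "cmod (\<psi> y ^ n) \<le> 1"
        by (simp add: norm_power power_le_one)
      show "cmod e1 \<le> 1"
        using w by (simp add: e1_def)
    qed
    ultimately show ?thesis by simp
  qed

  have err: "err_bound A r t k = 2 * (real r * (1 - p) ^ k) + sqrt (c\<^sup>2 * H / real k) + G k" for k
    by (simp add: err_bound_def Let_def p_def w_def c_def H_def K_def G_def)
  have triangle: "cmod (a - d) \<le> cmod (a - b) + cmod (b - c) + cmod (c - d)" for a b c d
    using norm_triangle_ineq[of "a - b" "b - c"] norm_triangle_ineq[of "a - c" "c - d"] by simp
  \<comment> \<open>The estimate of the degenerate part uses only its term in \<open>m\<close>; the
    one in \<open>n\<close> is added to make the bound symmetric.\<close>
  have "0 \<le> sqrt (c\<^sup>2 * H / real n)"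
    using H by simp
  have "cmod (average ?S (\<lambda>(P, Q). iexp (t * Z (P * Q\<^sup>T))) - complex_of_real (exp (- t\<^sup>2 / 2)))
      \<le> cmod (average ?S (\<lambda>(P, Q). iexp (t * Z (P * Q\<^sup>T))) - average T (\<lambda>(P, Q). iexp (t * Z (P * Q\<^sup>T))))
        + cmod (average T (\<lambda>(P, Q). iexp (t * Z (P * Q\<^sup>T))) - \<psi> x ^ m * \<psi> y ^ n)
        + cmod (\<psi> x ^ m * \<psi> y ^ n - complex_of_real (exp (- t\<^sup>2 / 2)))"
    by (rule triangle)
  also have "\<dots> \<le> (2 * (real r * (1 - p) ^ m) + 2 * (real r * (1 - p) ^ n)) + sqrt (c\<^sup>2 * H / real m) + (G m + G n)"
    by (intro add_mono 1 2[unfolded 3] 4)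
  also have "\<dots> \<le> err_bound A r t m + err_bound A r t n"
    unfolding err using \<open>0 \<le> sqrt (c\<^sup>2 * H / real n)\<close> by linarith
  finally show ?thesis
    unfolding char_eq .
qed

section \<open>The double limit\<close>

text \<open>If convergence failed, some sequence of index pairs with both coordinates tending to
  infinity would keep the distribution functions a fixed distance \<open>e\<close> from the limit,
  contradicting Levy's theorem along that sequence.\<close>

lemma weak_conv_along_prod_if_char:
  fixes M :: "nat \<times> nat \<Rightarrow> real measure"
  assumes M: "\<And>i. real_distribution (M i)" and M': "real_distribution M'"
    and char: "\<And>t. ((\<lambda>i. char (M i) t) \<longlongrightarrow> char M' t) (sequentially \<times>\<^sub>F sequentially)"
  shows "weak_conv_along (sequentially \<times>\<^sub>F sequentially) M M'"
  unfolding weak_conv_along_def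
proof (intro allI impI, rule ccontr)
  let ?F = "sequentially \<times>\<^sub>F sequentially :: (nat \<times> nat) filter"
  fix x assume x: "isCont (cdf M') x" and not: "\<not> ((\<lambda>i. cdf (M i) x) \<longlongrightarrow> cdf M' x) ?F"
  then obtain e where e: "0 < e" "\<not> (\<forall>\<^sub>F i in ?F. dist (cdf (M i) x) (cdf M' x) < e)"
    by (auto simp: tendsto_iff)
  \<comment> \<open>Every quadrant of pairs with both coordinates at least \<open>k\<close> contains
    a bad index, as otherwise the distance would eventually be below \<open>e\<close>.\<close>
  have "\<exists>i. k \<le> fst i \<and> k \<le> snd i \<and> e \<le> dist (cdf (M i) x) (cdf M' x)" for k
  proof (rule ccontr)
    assume none: "\<not> ?thesis"
    have "\<forall>\<^sub>F i in ?F. k \<le> fst i \<and> k \<le> snd i"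
      by (rule eventually_prodI[THEN eventually_mono, OF eventually_ge_at_top[of k] eventually_ge_at_top[of k]]) simp
    then have "\<forall>\<^sub>F i in ?F. dist (cdf (M i) x) (cdf M' x) < e"
      by (rule eventually_mono) (use none in force)
    with e(2) show False by simp
  qed
  then obtain s where s: "\<And>k. k \<le> fst (s k)" "\<And>k. k \<le> snd (s k)"
    "\<And>k. e \<le> dist (cdf (M (s k)) x) (cdf M' x)"
    by metis
  have "filterlim (\<lambda>k. fst (s k)) at_top sequentially" "filterlim (\<lambda>k. snd (s k)) at_top sequentially"
    using s by (auto intro: filterlim_at_top_mono[OF filterlim_ident])
  then have "filterlim s ?F sequentially"
    using filterlim_Pair[of "\<lambda>k. fst (s k)" sequentially sequentially "\<lambda>k. snd (s k)"] by simp
  then have "(\<lambda>k. char (M (s k)) t) \<longlonglongrightarrow> char M' t" for t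
    by (rule filterlim_compose[OF char])
  then have "weak_conv_m (\<lambda>k. M (s k)) M'"
    by (intro levy_continuity M M')
  then have "(\<lambda>k. cdf (M (s k)) x) \<longlonglongrightarrow> cdf M' x"
    using x by (auto simp: weak_conv_m_def weak_conv_def)
  then have "\<forall>\<^sub>F k in sequentially. dist (cdf (M (s k)) x) (cdf M' x) < e"
    using e(1) by (auto simp: tendsto_iff)
  then obtain k where "dist (cdf (M (s k)) x) (cdf M' x) < e"
    by (auto simp: eventually_sequentially)
  with s(3)[of k] show False by simp
qed

theorem theorem1p1:
  fixes A :: "'a::{field,finite} set" and r :: nat
  assumes "r > 0" and "A \<noteq> {}" and "A \<subset> UNIV"
  shows "weak_conv_along (sequentially \<times>\<^sub>F sequentially)
    (\<lambda>(m, n). distr (measure_pmf (uniform_rank_mat r m n)) borel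
       (\<lambda>N. (real (count_entries A N) - mu A r m n) / sqrt (sigma2 A r m n)))
    std_normal_distribution"
proof (rule weak_conv_along_prod_if_char)
  let ?F = "sequentially \<times>\<^sub>F sequentially :: (nat \<times> nat) filter"
  let ?D = "\<lambda>m n. distr (measure_pmf (uniform_rank_mat r m n)) borel
       (\<lambda>N. (real (count_entries A N) - mu A r m n) / sqrt (sigma2 A r m n))"
  show "real_distribution (case i of (m, n) \<Rightarrow> ?D m n)" for i
    by (cases i) (auto intro!: prob_space.real_distribution_distr prob_space_measure_pmf)
  fix t :: real
  \<comment> \<open>For smaller dimensions there is no matrix of rank \<open>r\<close> and
    \<open>pmf_of_set\<close> is not a uniform distribution; the limit ignores these
    indices.\<close>
  have "\<forall>\<^sub>F i in ?F. r \<le> fst i \<and> r \<le> snd i"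
    by (rule eventually_prodI[THEN eventually_mono, OF eventually_ge_at_top[of r] eventually_ge_at_top[of r]]) simp
  then have "\<forall>\<^sub>F i in ?F. cmod (char (case i of (m, n) \<Rightarrow> ?D m n) t - complex_of_real (exp (- t\<^sup>2 / 2)))
      \<le> err_bound A r t (fst i) + err_bound A r t (snd i)"
    by (rule eventually_mono) (use char_rank_mat_approx[OF assms, of _ _ t] in force)
  moreover have "((\<lambda>i. err_bound A r t (fst i) + err_bound A r t (snd i)) \<longlongrightarrow> 0) ?F"
    by (intro tendsto_add_zero filterlim_compose[OF err_bound_tendsto_0] filterlim_fst filterlim_snd)
  ultimately have "((\<lambda>i. char (case i of (m, n) \<Rightarrow> ?D m n) t - complex_of_real (exp (- t\<^sup>2 / 2))) \<longlongrightarrow> 0) ?F"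
    by (rule Lim_null_comparison)
  then show "((\<lambda>i. char (case i of (m, n) \<Rightarrow> ?D m n) t) \<longlongrightarrow> char std_normal_distribution t) ?F"
    unfolding char_std_normal_distribution by (rule LIM_zero_cancel)
qed (rule real_dist_normal_dist)

end
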